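(* Let $k\ge 0$ be an integer. Let $f,g:\mathcal X\times\mathcal X\to\mathcal X$ and $a_0,b_0:[0,r]\to\mathcal X$ be smooth enough functions, and let the family of discrete 2D hyperbolic systems $\delta^\epsilon_y a=f^\epsilon(a,b)$, $\delta^\epsilon_x b=g^\epsilon(a,b)$ be an $\mathcal O(\epsilon)$-approximation in the $C^1$ sense of $\partial_y a=f(a,b)$, $\partial_x b=g(a,b)$. Let the discrete data $a_0^\epsilon,b_0^\epsilon:[0,r]^\epsilon\to\mathcal X$ satisfy $a_0^\epsilon=a_0+\mathcal O(\epsilon)$, $b_0^\epsilon=b_0+\mathcal O(\epsilon)$ uniformly on $[0,r]^\epsilon$, and let $(a^\epsilon,b^\epsilon)$ be the solution on $\Omega^\epsilon(r)$ of the discrete Goursat problem with $a^\epsilon(x,0)=a_0^\epsilon(x)$, $b^\epsilon(0,y)=b_0^\epsilon(y)$. Let $\bar r\in(0,r]$ and Lipschitz-continuous $a,b:\Omega(\bar r)\to\mathcal X$ be such that $a^\epsilon=a+\mathcal O(\epsilon)$, $b^\epsilon=b+\mathcal O(\epsilon)$ uniformly on $\Omega^\epsilon(\bar r)$, and $(a,b)$ solves the continuous Goursat problem with data $a(x,0)=a_0(x)$, $b(0,y)=b_0(y)$ on $\Omega(\bar r)$ (such $\bar r,a,b$ exist under the preceding assumptions). Assume additionally that the difference quotients up to order $k+1$ of the discrete initial data are bounded uniformly and independently of $\epsilon$: $$|(\delta^\epsilon_x)^m a_0^\epsilon(x)|\le M,\qquad |(\delta^\epsilon_y)^n b_0^\epsilon(y)|\le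 M,\qquad m,n\le k+1,$$ and that the convergence $f^\epsilon\to f$, $g^\epsilon\to g$ is locally uniform in $C^{k+1}$. Then the limit functions $a=\lim_{\epsilon\to0}a^\epsilon$ and $b=\lim_{\epsilon\to0}b^\epsilon$ belong to $C^k$, and moreover these limits are uniform in $C^k$: for $m+n\le k$, $$\sup_{\Omega^\epsilon(\bar r-k\epsilon)}\big|(\delta^\epsilon_x)^m(\delta^\epsilon_y)^n a^\epsilon-\partial_x^m\partial_y^n a\big|\to0,\qquad \sup_{\Omega^\epsilon(\bar r-k\epsilon)}\big|(\delta^\epsilon_x)^m(\delta^\epsilon_y)^n b^\epsilon-\partial_x^m\partial_y^n b\big|\to0\qquad(\epsilon\to0).$$
   Context: $\mathcal X$ is a normed vector space with norm $|\cdot|$, and $r>0$. For $\rho>0$ put $\Omega(\rho)=[0,\rho]\times[0,\rho]\subset\mathbb R^2$, $[0,\rho]^\epsilon=[0,\rho]\cap(\epsilon\mathbb Z)$, $\Omega^\epsilon(\rho)=[0,\rho]^\epsilon\times[0,\rho]^\epsilon$. The mesh size $\epsilon$ takes only values $2^{-j}$ with $j$ a positive integer and $\epsilon<\epsilon_0$ for a fixed $\epsilon_0>0$; $\mathcal O(\epsilon)$ means bounded in norm by $C\epsilon$ with $C$ independent of $\epsilon$ and, when "uniformly" is said, of the indicated variables. Difference quotients: $\delta^\epsilon_x p(x,y)=\frac1\epsilon(p(x+\epsilon,y)-p(x,y))$, $\delta^\epsilon_y p(x,y)=\frac1\epsilon(p(x,y+\epsilon)-p(x,y))$ (analogously for functions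 of one variable), defined where the shifted point is also in the grid domain. A discrete 2D hyperbolic system, for functions $a,b:\Omega^\epsilon(r)\to\mathcal X$, is $\delta^\epsilon_y a=f^\epsilon(a,b)$, $\delta^\epsilon_x b=g^\epsilon(a,b)$ (required wherever the left sides are defined), with smooth $f^\epsilon,g^\epsilon:\mathcal X\times\mathcal X\to\mathcal X$; its Goursat problem prescribes $a(x,0)$ and $b(0,y)$ for $x,y\in[0,r]^\epsilon$ and has a unique solution. The continuous Goursat problem for $\partial_y a=f(a,b)$, $\partial_x b=g(a,b)$ prescribes $a(x,0)$ and $b(0,y)$. The family is an $\mathcal O(\epsilon)$-approximation in the $C^1$ sense of the continuous system if $f^\epsilon,g^\epsilon$ depend continuously on $\epsilon\in(0,\epsilon_0)$ and $f^\epsilon=f+\mathcal O(\epsilon)$, $g^\epsilon=g+\mathcal O(\epsilon)$, together with the analogous relations for the first partial derivatives, uniformly on every compact subset of $\mathcal X\times\mathcal X$.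
   Formalization: The normed vector space X is assumed complete (a Banach space); over an incomplete X the limits need not be C^k for k ≥ 1, since the partial derivatives may lie only in the completion. *)

theory Defs
  imports "HOL-Analysis.Analysis"
begin

section \<open>Mesh sizes, grids, and uniform \<open>O(\<epsilon>)\<close>\<close>

definition mesh :: "real \<Rightarrow> real set" where
  "mesh \<epsilon>\<^sub>0 = {\<epsilon>. \<epsilon> < \<epsilon>\<^sub>0 \<and> (\<exists>j::nat. 1 \<le> j \<and> \<epsilon> = 1 / 2 ^ j)}"

definition square :: "real \<Rightarrow> (real \<times> real) set" where
  "square \<rho> = {0..\<rho>} \<times> {0..\<rho>}"

definition grid :: "real \<Rightarrow> real \<Rightarrow> real set" where
  "grid \<epsilon> \<rho> = {0..\<rho>} \<inter> range (\<lambda>i::int. \<epsilon> * of_int i)"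

definition grid_square :: "real \<Rightarrow> real \<Rightarrow> (real \<times> real) set" where
  "grid_square \<epsilon> \<rho> = grid \<epsilon> \<rho> \<times> grid \<epsilon> \<rho>"

definition O_eps_on ::
  "real \<Rightarrow> (real \<Rightarrow> 'i set) \<Rightarrow> (real \<Rightarrow> 'i \<Rightarrow> 'a::real_normed_vector) \<Rightarrow> bool" where
  "O_eps_on \<epsilon>\<^sub>0 S h \<longleftrightarrow> (\<exists>C. \<forall>\<epsilon>\<in>mesh \<epsilon>\<^sub>0. \<forall>z\<in>S \<epsilon>. norm (h \<epsilon> z) \<le> C * \<epsilon>)"

section \<open>Difference quotients\<close>

text \<open>
  These operators are total. The \<open>m\<close>-fold iterate at \<open>x\<close> only involves the values at
  \<open>x, x + \<epsilon>, \<dots>, x + m \<epsilon>\<close>, so for a function on a grid it is meaningful exactly when both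
  \<open>x\<close> and \<open>x + m \<epsilon>\<close> belong to that grid.
\<close>

definition dq :: "real \<Rightarrow> (real \<Rightarrow> 'a::real_vector) \<Rightarrow> real \<Rightarrow> 'a" where
  "dq \<epsilon> p = (\<lambda>x. (1 / \<epsilon>) *\<^sub>R (p (x + \<epsilon>) - p x))"

definition dq_x :: "real \<Rightarrow> (real \<Rightarrow> real \<Rightarrow> 'a::real_vector) \<Rightarrow> real \<Rightarrow> real \<Rightarrow> 'a" where
  "dq_x \<epsilon> p = (\<lambda>x y. (1 / \<epsilon>) *\<^sub>R (p (x + \<epsilon>) y - p x y))"

definition dq_y :: "real \<Rightarrow> (real \<Rightarrow> real \<Rightarrow> 'a::real_vector) \<Rightarrow> real \<Rightarrow> real \<Rightarrow> 'a" where
  "dq_y \<epsilon> p = (\<lambda>x y. (1 / \<epsilon>) *\<^sub>R (p x (y + \<epsilon>) - p x y))"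

section \<open>Functions of class \<open>C\<^sup>k\<close>\<close>

text \<open>
  The higher Frechet derivatives, evaluated at a list of directions:
  \<open>iter_deriv f [v\<^sub>1, \<dots>, v\<^sub>j] z\<close> is \<open>D\<^sup>jf(z)(v\<^sub>1, \<dots>, v\<^sub>j)\<close>. In \<open>C_k\<close> and \<open>C_k_limit\<close> uniformity over
  \<open>unit_lists j\<close> expresses convergence in the operator norm of \<open>j\<close>-linear maps. Given this
  continuity, differentiability for each fixed list of directions implies differentiability
  in the operator norm, so \<open>C_k\<close> is the usual notion on normed spaces.
\<close>

fun iter_deriv ::
  "('a::real_normed_vector \<Rightarrow> 'b::real_normed_vector) \<Rightarrow> 'a list \<Rightarrow> 'a \<Rightarrow> 'b" where
  "iter_deriv f [] = f"
| "iter_deriv f (v # vs) = (\<lambda>z. frechet_derivative (iter_deriv f vs) (at z) v)"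

definition unit_lists :: "nat \<Rightarrow> 'a::real_normed_vector list set" where
  "unit_lists j = {vs. length vs = j \<and> (\<forall>v\<in>set vs. norm v \<le> 1)}"

definition C_k :: "nat \<Rightarrow> ('a::real_normed_vector \<Rightarrow> 'b::real_normed_vector) \<Rightarrow> bool" where
  "C_k k f \<longleftrightarrow>
     (\<forall>vs. length vs < k \<longrightarrow> (\<forall>z. iter_deriv f vs differentiable (at z))) \<and>
     (\<forall>j\<le>k. \<forall>z. uniform_limit (unit_lists j)
        (\<lambda>w vs. iter_deriv f vs w) (\<lambda>vs. iter_deriv f vs z) (at z))"

definition C_infinity :: "('a::real_normed_vector \<Rightarrow> 'b::real_normed_vector) \<Rightarrow> bool" where
  "C_infinity f \<longleftrightarrow> (\<forall>n. C_k n f)"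

definition C_k_limit ::
  "nat \<Rightarrow> (real \<Rightarrow> 'a::real_normed_vector \<Rightarrow> 'b::real_normed_vector) \<Rightarrow>
     ('a \<Rightarrow> 'b) \<Rightarrow> real filter \<Rightarrow> bool" where
  "C_k_limit k F f \<F> \<longleftrightarrow>
     (\<forall>K. compact K \<longrightarrow> (\<forall>j\<le>k. uniform_limit (K \<times> unit_lists j)
        (\<lambda>\<epsilon> (z, vs). iter_deriv (F \<epsilon>) vs z) (\<lambda>(z, vs). iter_deriv f vs z) \<F>))"

definition C_1_interval :: "real \<Rightarrow> (real \<Rightarrow> 'a::real_normed_vector) \<Rightarrow> bool" where
  "C_1_interval \<rho> p \<longleftrightarrow>
     (\<exists>p'. (\<forall>x\<in>{0..\<rho>}. (p has_vector_derivative p' x) (at x within {0..\<rho>})) \<and>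
           continuous_on {0..\<rho>} p')"

text \<open>Partial derivatives on the closed square; they are one-sided on its boundary.\<close>

definition pd_x ::
  "real \<Rightarrow> (real \<Rightarrow> real \<Rightarrow> 'a::real_normed_vector) \<Rightarrow> real \<Rightarrow> real \<Rightarrow> 'a" where
  "pd_x \<rho> p = (\<lambda>x y. vector_derivative (\<lambda>s. p s y) (at x within {0..\<rho>}))"

definition pd_y ::
  "real \<Rightarrow> (real \<Rightarrow> real \<Rightarrow> 'a::real_normed_vector) \<Rightarrow> real \<Rightarrow> real \<Rightarrow> 'a" where
  "pd_y \<rho> p = (\<lambda>x y. vector_derivative (\<lambda>t. p x t) (at y within {0..\<rho>}))"

fun C_k_square :: "nat \<Rightarrow> real \<Rightarrow> (real \<Rightarrow> real \<Rightarrow> 'a::real_normed_vector) \<Rightarrow> bool" where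
  "C_k_square 0 \<rho> p \<longleftrightarrow> continuous_on (square \<rho>) (\<lambda>(x, y). p x y)"
| "C_k_square (Suc k) \<rho> p \<longleftrightarrow>
     continuous_on (square \<rho>) (\<lambda>(x, y). p x y) \<and>
     (\<forall>(x, y)\<in>square \<rho>.
        (\<lambda>s. p s y) differentiable (at x within {0..\<rho>}) \<and>
        (\<lambda>t. p x t) differentiable (at y within {0..\<rho>})) \<and>
     C_k_square k \<rho> (pd_x \<rho> p) \<and> C_k_square k \<rho> (pd_y \<rho> p)"

section \<open>Hyperbolic systems\<close>

definition discrete_goursat_solution ::
  "real \<Rightarrow> real \<Rightarrow> ('a \<times> 'a \<Rightarrow> 'a) \<Rightarrow> ('a \<times> 'a \<Rightarrow> 'a) \<Rightarrow> (real \<Rightarrow> 'a) \<Rightarrow> (real \<Rightarrow> 'a) \<Rightarrow>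
     (real \<Rightarrow> real \<Rightarrow> 'a::real_normed_vector) \<Rightarrow> (real \<Rightarrow> real \<Rightarrow> 'a) \<Rightarrow> bool" where
  "discrete_goursat_solution \<epsilon> \<rho> f g a\<^sub>0 b\<^sub>0 a b \<longleftrightarrow>
     (\<forall>x\<in>grid \<epsilon> \<rho>. \<forall>y\<in>grid \<epsilon> \<rho>. y + \<epsilon> \<in> grid \<epsilon> \<rho> \<longrightarrow> dq_y \<epsilon> a x y = f (a x y, b x y)) \<and>
     (\<forall>x\<in>grid \<epsilon> \<rho>. \<forall>y\<in>grid \<epsilon> \<rho>. x + \<epsilon> \<in> grid \<epsilon> \<rho> \<longrightarrow> dq_x \<epsilon> b x y = g (a x y, b x y)) \<and>
     (\<forall>x\<in>grid \<epsilon> \<rho>. a x 0 = a\<^sub>0 x) \<and> (\<forall>y\<in>grid \<epsilon> \<rho>. b 0 y = b\<^sub>0 y)"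

definition goursat_solution ::
  "real \<Rightarrow> ('a \<times> 'a \<Rightarrow> 'a) \<Rightarrow> ('a \<times> 'a \<Rightarrow> 'a) \<Rightarrow> (real \<Rightarrow> 'a) \<Rightarrow> (real \<Rightarrow> 'a) \<Rightarrow>
     (real \<Rightarrow> real \<Rightarrow> 'a::real_normed_vector) \<Rightarrow> (real \<Rightarrow> real \<Rightarrow> 'a) \<Rightarrow> bool" where
  "goursat_solution \<rho> f g a\<^sub>0 b\<^sub>0 a b \<longleftrightarrow>
     (\<forall>(x, y)\<in>square \<rho>.
        ((\<lambda>t. a x t) has_vector_derivative f (a x y, b x y)) (at y within {0..\<rho>}) \<and>
        ((\<lambda>s. b s y) has_vector_derivative g (a x y, b x y)) (at x within {0..\<rho>})) \<and>
     (\<forall>x\<in>{0..\<rho>}. a x 0 = a\<^sub>0 x) \<and> (\<forall>y\<in>{0..\<rho>}. b 0 y = b\<^sub>0 y)"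

definition partial_1 ::
  "('a::real_normed_vector \<times> 'a \<Rightarrow> 'a) \<Rightarrow> 'a \<times> 'a \<Rightarrow> 'a \<Rightarrow> 'a" where
  "partial_1 f z = frechet_derivative (\<lambda>u. f (u, snd z)) (at (fst z))"

definition partial_2 ::
  "('a::real_normed_vector \<times> 'a \<Rightarrow> 'a) \<Rightarrow> 'a \<times> 'a \<Rightarrow> 'a \<Rightarrow> 'a" where
  "partial_2 f z = frechet_derivative (\<lambda>v. f (fst z, v)) (at (snd z))"

definition C1_O_eps_approximation ::
  "real \<Rightarrow> (real \<Rightarrow> 'a \<times> 'a \<Rightarrow> 'a) \<Rightarrow> ('a::real_normed_vector \<times> 'a \<Rightarrow> 'a) \<Rightarrow> bool" where
  "C1_O_eps_approximation \<epsilon>\<^sub>0 F f \<longleftrightarrow>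
     (\<forall>z. continuous_on {0<..<\<epsilon>\<^sub>0} (\<lambda>\<epsilon>. F \<epsilon> z)) \<and>
     (\<forall>K. compact K \<longrightarrow>
        O_eps_on \<epsilon>\<^sub>0 (\<lambda>_. K) (\<lambda>\<epsilon> z. F \<epsilon> z - f z) \<and>
        O_eps_on \<epsilon>\<^sub>0 (\<lambda>_. K) (\<lambda>\<epsilon> z. onorm (\<lambda>u. partial_1 (F \<epsilon>) z u - partial_1 f z u)) \<and>
        O_eps_on \<epsilon>\<^sub>0 (\<lambda>_. K) (\<lambda>\<epsilon> z. onorm (\<lambda>v. partial_2 (F \<epsilon>) z v - partial_2 f z v)))"

end

theory Submission
  imports Defs
begin

text \<open>
  The difference quotients of order at most \<open>k + 1\<close> of the solutions stay bounded, by induction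
  on the order: through the equations, every quotient that contains \<open>\<delta>\<^sub>y\<close> (for \<open>a\<close>) or \<open>\<delta>\<^sub>x\<close> (for
  \<open>b\<close>) is a lower order quotient of \<open>f(a, b)\<close> or \<open>g(a, b)\<close>, and the discrete chain rule bounds
  these. The pure quotient \<open>\<delta>\<^sub>x\<^sup>s a\<close> satisfies a difference equation in \<open>y\<close> that is affine in it up
  to bounded terms, so the Gronwall inequality applies.

  Bounded sets of a Banach space need not be compact, so Arzela--Ascoli is not available. Instead,
  convergence of the functions and a bound on their second difference quotients already force the
  first difference quotients to converge: they differ from the slope over an interval of
  length \<open>h\<close> by \<open>O(h)\<close>, uniformly in the mesh size, and for fixed \<open>h\<close> these slopes converge.
\<close>

section \<open>Bounded difference quotients\<close>

text \<open>The Gronwall step needs an inequality linear in the top quotient, but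
  \<open>chain_const\<close> grows like a power of the bound put into it. Therefore the top quotient
  of \<open>u\<close> is isolated: in the mean value form of the quotient of f(u) it enters only
  through one direction of a derivative of \<open>f\<close>. By multilinearity this direction is
  scaled to unit bounds before the chain rule is applied and scaled back afterwards. Reaching order
  s + 1 in this way uses s + 1 derivatives of \<open>f\<close>, which is why convergence of order k
  + 1 is assumed.

  The chain rule interpolates between neighbouring grid values, so derivative bounds are wanted on
  the convex hull of the values, for all fine meshes at once, while \<open>F\<close> and
  \<open>G\<close> converge uniformly only on compact sets. The linear rate of convergence to a
  continuous limit on a compact square makes the values on all meshes together totally bounded, and
  in a Banach space the closed convex hull of such a set is compact.

  Derivatives of the limits are obtained as limits of Cauchy sequences of slopes. Each one uses a
  bound on second quotients, so order k + 1 yields k derivatives; each quotient also loses one grid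
  row, hence the grid on [0, rbar - k h].\<close>

definition dom_x :: "real \<Rightarrow> (real \<times> real) set \<Rightarrow> (real \<times> real) set" where
  "dom_x h D = {(x, y). (x, y) \<in> D \<and> (x + h, y) \<in> D}"

definition dom_y :: "real \<Rightarrow> (real \<times> real) set \<Rightarrow> (real \<times> real) set" where
  "dom_y h D = {(x, y). (x, y) \<in> D \<and> (x, y + h) \<in> D}"

text \<open>Quotients are taken in every order of x and y, and each one shrinks the domain to the
  points whose shifted partner is present, so no value outside \<open>D\<close> is read.
  \<open>D\<close> is an arbitrary set because the estimate of a single top quotient is localised to
  a finite row.\<close>

fun dq_bounded ::
  "real \<Rightarrow> nat \<Rightarrow> (real \<times> real) set \<Rightarrow> real \<Rightarrow> (real \<Rightarrow> real \<Rightarrow> 'a::real_normed_vector) \<Rightarrow> bool" where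
  "dq_bounded h 0 D C u \<longleftrightarrow> (\<forall>x y. (x, y) \<in> D \<longrightarrow> norm (u x y) \<le> C)"
| "dq_bounded h (Suc s) D C u \<longleftrightarrow>
     (\<forall>x y. (x, y) \<in> D \<longrightarrow> norm (u x y) \<le> C) \<and>
     dq_bounded h s (dom_x h D) C (dq_x h u) \<and> dq_bounded h s (dom_y h D) C (dq_y h u)"

lemma dom_mono: "D' \<subseteq> D \<Longrightarrow> dom_x h D' \<subseteq> dom_x h D" "D' \<subseteq> D \<Longrightarrow> dom_y h D' \<subseteq> dom_y h D"
  by (auto simp: dom_x_def dom_y_def)

lemma dom_subset: "dom_x h D \<subseteq> D" "dom_y h D \<subseteq> D"
  by (auto simp: dom_x_def dom_y_def)

lemma mem_swap_image: "(x, y) \<in> prod.swap ` D \<longleftrightarrow> (y, x) \<in> D"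
  by force

lemma dom_x_swap: "dom_x h (prod.swap ` D) = prod.swap ` dom_y h D"
  and dom_y_swap: "dom_y h (prod.swap ` D) = prod.swap ` dom_x h D"
  by (auto simp: dom_x_def dom_y_def mem_swap_image)

lemma dom_x_dom_y: "dom_y h (dom_x h D) = dom_x h (dom_y h D)"
  by (auto simp: dom_x_def dom_y_def)

lemma funpow_dom_x: "(x, y) \<in> (dom_x h ^^ m) D \<longleftrightarrow> (\<forall>i\<le>m. (x + real i * h, y) \<in> D)"
proof (induction m arbitrary: x)
  case (Suc m)
  have "(x, y) \<in> (dom_x h ^^ Suc m) D
      \<longleftrightarrow> (\<forall>i\<le>m. (x + real i * h, y) \<in> D) \<and> (\<forall>i\<le>m. (x + real (Suc i) * h, y) \<in> D)"
    using Suc[of x] Suc[of "x + h"]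
    unfolding funpow.simps comp_def dom_x_def[where D = "(dom_x h ^^ m) D"]
    by (simp add: algebra_simps)
  also have "\<dots> \<longleftrightarrow> (\<forall>i\<le>Suc m. (x + real i * h, y) \<in> D)"
  proof safe
    fix i assume "\<forall>i\<le>m. (x + real i * h, y) \<in> D" "\<forall>i\<le>m. (x + real (Suc i) * h, y) \<in> D" "i \<le> Suc m"
    then show "(x + real i * h, y) \<in> D" by (cases i) auto
  qed auto
  finally show ?case .
qed auto

section \<open>Algebra of the difference quotients and of their bounds\<close>

lemma dq_x_flip: "dq_x h (\<lambda>x y. u y x) = (\<lambda>x y. dq_y h u y x)"
  and dq_y_flip: "dq_y h (\<lambda>x y. u y x) = (\<lambda>x y. dq_x h u y x)"
  by (simp_all add: dq_x_def dq_y_def)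

lemma dq_y_dq_x: "dq_y h (dq_x h u) = dq_x h (dq_y h u)"
  by (auto simp: dq_x_def dq_y_def algebra_simps fun_eq_iff)

lemma dq_y_funpow_dq_x: "dq_y h ((dq_x h ^^ m) u) = (dq_x h ^^ m) (dq_y h u)"
  by (induction m) (simp_all add: dq_y_dq_x)

lemma dq_add:
  "dq_x h (\<lambda>x y. u x y + v x y) = (\<lambda>x y. dq_x h u x y + dq_x h v x y)"
  "dq_y h (\<lambda>x y. u x y + v x y) = (\<lambda>x y. dq_y h u x y + dq_y h v x y)"
  by (simp_all add: dq_x_def dq_y_def algebra_simps fun_eq_iff)

lemma dq_diff:
  "dq_x h (\<lambda>x y. u x y - v x y) = (\<lambda>x y. dq_x h u x y - dq_x h v x y)"
  "dq_y h (\<lambda>x y. u x y - v x y) = (\<lambda>x y. dq_y h u x y - dq_y h v x y)"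
  by (simp_all add: dq_x_def dq_y_def algebra_simps fun_eq_iff)

lemma dq_scaleR:
  "dq_x h (\<lambda>x y. c *\<^sub>R u x y) = (\<lambda>x y. c *\<^sub>R dq_x h u x y)"
  "dq_y h (\<lambda>x y. c *\<^sub>R u x y) = (\<lambda>x y. c *\<^sub>R dq_y h u x y)"
  by (simp_all add: dq_x_def dq_y_def algebra_simps fun_eq_iff)

lemma dq_Pair:
  "dq_x h (\<lambda>x y. (u x y, v x y)) = (\<lambda>x y. (dq_x h u x y, dq_x h v x y))"
  "dq_y h (\<lambda>x y. (u x y, v x y)) = (\<lambda>x y. (dq_y h u x y, dq_y h v x y))"
  by (simp_all add: dq_x_def dq_y_def fun_eq_iff)

lemma funpow_dq_x_Pair:
  "(dq_x h ^^ m) (\<lambda>x y. (u x y, v x y)) = (\<lambda>x y. ((dq_x h ^^ m) u x y, (dq_x h ^^ m) v x y))"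
  by (induction m) (simp_all add: dq_Pair)

lemma dq_bounded_norm: "dq_bounded h s D C u \<Longrightarrow> (x, y) \<in> D \<Longrightarrow> norm (u x y) \<le> C"
  by (cases s) auto

lemma dq_bounded_mono:
  "dq_bounded h s D C u \<Longrightarrow> D' \<subseteq> D \<Longrightarrow> C \<le> C' \<Longrightarrow> s' \<le> s \<Longrightarrow> dq_bounded h s' D' C' u"
proof (induction s' arbitrary: s D D' u)
  case 0
  then show ?case using dq_bounded_norm[OF 0(1)] by (auto intro: order_trans)
next
  case (Suc s')
  then obtain t where t: "s = Suc t" "s' \<le> t" by (cases s) auto
  with Suc.prems have *: "dq_bounded h t (dom_x h D) C (dq_x h u)" "dq_bounded h t (dom_y h D) C (dq_y h u)"
    by auto
  show ?case
    using Suc.IH[OF *(1) dom_mono(1)[OF Suc.prems(2)] Suc.prems(3) t(2)]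
      Suc.IH[OF *(2) dom_mono(2)[OF Suc.prems(2)] Suc.prems(3) t(2)]
      dq_bounded_norm[OF Suc.prems(1)] Suc.prems(2,3) by (auto intro: order_trans)
qed

lemma dq_bounded_cong:
  "(\<And>x y. (x, y) \<in> D \<Longrightarrow> u x y = v x y) \<Longrightarrow> dq_bounded h s D C u \<longleftrightarrow> dq_bounded h s D C v"
proof (induction s arbitrary: D u v)
  case (Suc s)
  have "dq_bounded h s (dom_x h D) C (dq_x h u) \<longleftrightarrow> dq_bounded h s (dom_x h D) C (dq_x h v)"
    "dq_bounded h s (dom_y h D) C (dq_y h u) \<longleftrightarrow> dq_bounded h s (dom_y h D) C (dq_y h v)"
    by (intro Suc.IH; use Suc.prems in \<open>auto simp: dom_x_def dom_y_def dq_x_def dq_y_def\<close>)+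
  with Suc.prems show ?case by auto
qed auto

text \<open>The family of all mixed quotients is symmetric in the two variables, so estimates are
  proved for \<open>dq_x\<close> and transported to \<open>dq_y\<close> by exchanging the
  arguments.\<close>

lemma dq_bounded_flip:
  "dq_bounded h s D C (\<lambda>x y. u y x) \<longleftrightarrow> dq_bounded h s (prod.swap ` D) C u"
proof (induction s arbitrary: D u)
  case (Suc s)
  show ?case
    unfolding dq_bounded.simps dom_x_swap dom_y_swap dq_x_flip[of h u] dq_y_flip[of h u]
      Suc.IH[of "dom_x h D" "dq_y h u"] Suc.IH[of "dom_y h D" "dq_x h u"]
    by (auto simp: mem_swap_image)
qed (auto simp: mem_swap_image)

lemma dq_bounded_flipI: "dq_bounded h s D C u \<Longrightarrow> dq_bounded h s (prod.swap ` D) C (\<lambda>x y. u y x)"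
  using dq_bounded_flip[of h s "prod.swap ` D" C u] by (simp add: image_image)

lemma dq_bounded_add:
  "dq_bounded h s D C u \<Longrightarrow> dq_bounded h s D C' v \<Longrightarrow> dq_bounded h s D (C + C') (\<lambda>x y. u x y + v x y)"
  by (induction s arbitrary: D u v) (auto simp: dq_add intro!: norm_triangle_mono)

lemma dq_bounded_Pair:
  "dq_bounded h s D C u \<Longrightarrow> dq_bounded h s D C' v \<Longrightarrow> dq_bounded h s D (C + C') (\<lambda>x y. (u x y, v x y))"
  by (induction s arbitrary: D u v)
    (auto simp: dq_Pair intro!: order_trans[OF norm_Pair_le] add_mono)

lemma dq_bounded_scaleR:
  "dq_bounded h s D C u \<Longrightarrow> dq_bounded h s D (\<bar>c\<bar> * C) (\<lambda>x y. c *\<^sub>R u x y)"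
  by (induction s arbitrary: D u) (auto simp: dq_scaleR intro!: mult_left_mono)

lemma dq_bounded_shift:
  "dq_bounded h s D C u \<Longrightarrow> (\<And>x y. (x, y) \<in> D' \<Longrightarrow> (x + h, y) \<in> D) \<Longrightarrow>
    dq_bounded h s D' C (\<lambda>x y. u (x + h) y)"
proof (induction s arbitrary: D D' u)
  case (Suc s)
  have u: "dq_bounded h s (dom_x h D) C (dq_x h u)" "dq_bounded h s (dom_y h D) C (dq_y h u)"
    using Suc.prems(1) by simp_all
  have "dq_bounded h s (dom_x h D') C (\<lambda>x y. dq_x h u (x + h) y)"
    by (rule Suc.IH[OF u(1)]) (use Suc.prems(2) in \<open>unfold dom_x_def, blast\<close>)
  moreover have "dq_bounded h s (dom_y h D') C (\<lambda>x y. dq_y h u (x + h) y)"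
    by (rule Suc.IH[OF u(2)]) (use Suc.prems(2) in \<open>unfold dom_y_def, blast\<close>)
  moreover have "norm (u (x + h) y) \<le> C" if "(x, y) \<in> D'" for x y
    using dq_bounded_norm[OF Suc.prems(1) Suc.prems(2)[OF that]] .
  moreover have "dq_x h (\<lambda>x y. u (x + h) y) = (\<lambda>x y. dq_x h u (x + h) y)"
    "dq_y h (\<lambda>x y. u (x + h) y) = (\<lambda>x y. dq_y h u (x + h) y)"
    by (simp_all add: dq_x_def dq_y_def)
  ultimately show ?case by auto
qed auto

lemma norm_mvt:
  fixes p :: "real \<Rightarrow> 'a::real_normed_vector"
  assumes "\<And>t. t \<in> {0..1} \<Longrightarrow> (p has_vector_derivative p' t) (at t within {0..1})"
    and "\<And>t. t \<in> {0..1} \<Longrightarrow> norm (p' t) \<le> C"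
  shows "norm (p 1 - p 0) \<le> C"
proof -
  have "norm (p 1 - p 0) \<le> C * norm (1 - 0 :: real)"
  proof (rule differentiable_bound[where S = "{0..1}" and f' = "\<lambda>t z. z *\<^sub>R p' t"])
    fix t :: real assume t: "t \<in> {0..1}"
    show "(p has_derivative (\<lambda>z. z *\<^sub>R p' t)) (at t within {0..1})"
      using assms(1)[OF t] by (simp add: has_vector_derivative_def)
    show "onorm (\<lambda>z. z *\<^sub>R p' t) \<le> C"
      using assms(2)[OF t] by (intro onorm_le) (auto simp: mult.commute[of C] intro!: mult_left_mono)
  qed auto
  then show ?thesis by simp
qed

text \<open>A quotient at a point is a fixed linear combination of values, so it commutes with d/dt;
  the mean value inequality then applies to each quotient separately, with the same
  constant.\<close>

lemma dq_bounded_mvt: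
  assumes "\<And>x y t. (x, y) \<in> D \<Longrightarrow> t \<in> {0..1} \<Longrightarrow>
      ((\<lambda>t. p t x y) has_vector_derivative p' t x y) (at t within {0..1})"
    and "\<And>t. t \<in> {0..1} \<Longrightarrow> dq_bounded h s D C (p' t)"
  shows "dq_bounded h s D C (\<lambda>x y. p 1 x y - p 0 x y)"
  using assms
proof (induction s arbitrary: D p p')
  case 0
  show ?case using norm_mvt[OF 0(1)] dq_bounded_norm[OF 0(2)] by auto
next
  case (Suc s)
  have "dq_bounded h s (dom_x h D) C (\<lambda>x y. dq_x h (p 1) x y - dq_x h (p 0) x y)"
    by (rule Suc.IH[where p = "\<lambda>t. dq_x h (p t)" and p' = "\<lambda>t. dq_x h (p' t)"])
      (use Suc.prems in \<open>auto simp: dq_x_def dom_x_def intro!: has_vector_derivative_diff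
          bounded_linear.has_vector_derivative[OF bounded_linear_scaleR_right]\<close>)
  moreover have "dq_bounded h s (dom_y h D) C (\<lambda>x y. dq_y h (p 1) x y - dq_y h (p 0) x y)"
    by (rule Suc.IH[where p = "\<lambda>t. dq_y h (p t)" and p' = "\<lambda>t. dq_y h (p' t)"])
      (use Suc.prems in \<open>auto simp: dq_y_def dom_y_def intro!: has_vector_derivative_diff
          bounded_linear.has_vector_derivative[OF bounded_linear_scaleR_right]\<close>)
  moreover have "norm (p 1 x y - p 0 x y) \<le> C" if "(x, y) \<in> D" for x y
    using norm_mvt[OF Suc.prems(1)[OF that]] dq_bounded_norm[OF Suc.prems(2) that] by blast
  ultimately show ?case by (auto simp: dq_diff)
qed

section \<open>The discrete chain rule\<close>

lemma C_infinity_differentiable: "C_infinity f \<Longrightarrow> iter_deriv f vs differentiable (at z)"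
  unfolding C_infinity_def C_k_def by (meson lessI)

lemma C_infinity_has_derivative:
  "C_infinity f \<Longrightarrow> (iter_deriv f vs has_derivative (\<lambda>v. iter_deriv f (v # vs) z)) (at z)"
  using C_infinity_differentiable[of f vs z] frechet_derivative_works[of "iter_deriv f vs" "at z"]
  by (simp add: eta_contract_eq)

text \<open>The head slot is linear because it is the argument of a Frechet derivative. Additivity
  in a deeper slot is an identity between functions of \<open>z\<close>; differentiating it carries
  it past each further direction.\<close>

lemma iter_deriv_add:
  assumes "C_infinity f"
  shows "iter_deriv f (xs @ (v + w) # ys) z = iter_deriv f (xs @ v # ys) z + iter_deriv f (xs @ w # ys) z"
proof (induction xs arbitrary: z)
  case Nil
  show ?case
    using has_derivative_linear[OF C_infinity_has_derivative[OF assms]] by (simp add: linear_add)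
next
  case (Cons x xs)
  have eq: "iter_deriv f (xs @ (v + w) # ys) =
      (\<lambda>z. iter_deriv f (xs @ v # ys) z + iter_deriv f (xs @ w # ys) z)"
    using Cons by blast
  have "(iter_deriv f (xs @ (v + w) # ys) has_derivative
      (\<lambda>x. iter_deriv f (x # xs @ v # ys) z + iter_deriv f (x # xs @ w # ys) z)) (at z)"
    unfolding eq by (intro has_derivative_add C_infinity_has_derivative assms)
  then show ?case
    using has_derivative_unique[OF _ C_infinity_has_derivative[OF assms]]
    by (metis (no_types, lifting) append_Cons)
qed

lemma iter_deriv_scaleR:
  assumes "C_infinity f"
  shows "iter_deriv f (xs @ (c *\<^sub>R v) # ys) z = c *\<^sub>R iter_deriv f (xs @ v # ys) z"
proof (induction xs arbitrary: z)
  case Nil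
  show ?case
    using has_derivative_linear[OF C_infinity_has_derivative[OF assms]] by (simp add: linear_cmul)
next
  case (Cons x xs)
  have eq: "iter_deriv f (xs @ (c *\<^sub>R v) # ys) = (\<lambda>z. c *\<^sub>R iter_deriv f (xs @ v # ys) z)"
    using Cons by blast
  have "(iter_deriv f (xs @ (c *\<^sub>R v) # ys) has_derivative
      (\<lambda>x. c *\<^sub>R iter_deriv f (x # xs @ v # ys) z)) (at z)"
    unfolding eq by (intro has_derivative_scaleR_right C_infinity_has_derivative assms)
  then show ?case
    using has_derivative_unique[OF _ C_infinity_has_derivative[OF assms]]
    by (metis (no_types, lifting) append_Cons)
qed

lemma iter_deriv_diff:
  assumes "C_infinity f"
  shows "iter_deriv f (xs @ (v - w) # ys) z = iter_deriv f (xs @ v # ys) z - iter_deriv f (xs @ w # ys) z"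
  using iter_deriv_add[OF assms, of xs v "(-1) *\<^sub>R w" ys z] iter_deriv_scaleR[OF assms, of xs "-1" w]
  by simp

lemma iter_deriv_segment:
  assumes "C_infinity f"
  shows "((\<lambda>t. iter_deriv f vs ((1 - t) *\<^sub>R p + t *\<^sub>R q)) has_vector_derivative
    iter_deriv f ((q - p) # vs) ((1 - t) *\<^sub>R p + t *\<^sub>R q)) (at t within S)"
proof -
  have *: "((\<lambda>t. (1 - t) *\<^sub>R p + t *\<^sub>R q) has_vector_derivative (q - p)) (at t within S)"
    unfolding has_vector_derivative_def
    by (auto intro!: derivative_eq_intros simp: algebra_simps)
  have "(iter_deriv f vs has_derivative (\<lambda>v. iter_deriv f (v # vs) ((1 - t) *\<^sub>R p + t *\<^sub>R q)))
      (at ((1 - t) *\<^sub>R p + t *\<^sub>R q) within (\<lambda>t. (1 - t) *\<^sub>R p + t *\<^sub>R q) ` S)"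
    using C_infinity_has_derivative[OF assms] by (rule has_derivative_at_withinI)
  from vector_derivative_diff_chain_within[OF * this] show ?thesis
    by (simp add: comp_def)
qed

text \<open>The product of norms expresses an operator norm bound for multilinear maps; one constant
  serves all orders up to \<open>n\<close>, the function itself included.\<close>

definition deriv_bound ::
  "('a::real_normed_vector \<Rightarrow> 'b::real_normed_vector) \<Rightarrow> nat \<Rightarrow> 'a set \<Rightarrow> real \<Rightarrow> bool" where
  "deriv_bound f n K C \<longleftrightarrow>
     (\<forall>z\<in>K. \<forall>vs. length vs \<le> n \<longrightarrow> norm (iter_deriv f vs z) \<le> C * prod_list (map norm vs))"

lemma deriv_boundD:
  "deriv_bound f n K C \<Longrightarrow> z \<in> K \<Longrightarrow> length vs \<le> n \<Longrightarrow>
    norm (iter_deriv f vs z) \<le> C * prod_list (map norm vs)"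
  unfolding deriv_bound_def by blast

lemma deriv_bound_mono:
  "deriv_bound f n K C \<Longrightarrow> n' \<le> n \<Longrightarrow> K' \<subseteq> K \<Longrightarrow> deriv_bound f n' K' C"
  unfolding deriv_bound_def by (meson dual_order.trans subsetD)

text \<open>The recursion mirrors the product rule: one more quotient hits one of the
  \<open>j\<close> directions, which keeps their number, or the base point, which adds a direction.
  The term \<open>C * C ^ j\<close> covers the values themselves.\<close>

fun chain_const :: "real \<Rightarrow> nat \<Rightarrow> nat \<Rightarrow> real" where
  "chain_const C 0 j = C * C ^ j"
| "chain_const C (Suc s) j =
     C * C ^ j + real j * chain_const C s j + chain_const C s (Suc j)"

lemma chain_const_nonneg: "0 \<le> C \<Longrightarrow> 0 \<le> chain_const C s j"
  by (induction s arbitrary: j) auto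

text \<open>Directions are themselves grid functions: this larger family, unlike the compositions
  f(u) alone, is closed under difference quotients up to sums and interpolation of the base point,
  so the induction runs over it.\<close>

abbreviation comp_deriv where
  "comp_deriv f ws u \<equiv> (\<lambda>x y. iter_deriv f (map (\<lambda>w. w x y) ws) (u x y))"

abbreviation hull_of :: "(real \<times> real) set \<Rightarrow> (real \<Rightarrow> real \<Rightarrow> 'a::real_normed_vector) \<Rightarrow> 'a set" where
  "hull_of D u \<equiv> convex hull (case_prod u ` D)"

lemma prod_list_map_le:
  "(\<And>w. w \<in> set ws \<Longrightarrow> norm (g w) \<le> C) \<Longrightarrow> prod_list (map norm (map g ws)) \<le> C ^ length ws"
proof (induction ws)
  case (Cons w ws)
  have "0 \<le> C" using Cons.prems[of w] order_trans[OF norm_ge_zero] by auto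
  with Cons show ?case by (auto intro!: mult_mono prod_list_nonneg)
qed simp

lemma comp_deriv_bound_0:
  assumes "deriv_bound f (length ws) (case_prod u ` D) C" "0 \<le> C"
    and "\<And>w. w \<in> set ws \<Longrightarrow> dq_bounded h s D C w" and "(x, y) \<in> D"
  shows "norm (comp_deriv f ws u x y) \<le> C * C ^ length ws"
proof -
  have "norm (comp_deriv f ws u x y) \<le> C * prod_list (map norm (map (\<lambda>w. w x y) ws))"
    by (rule deriv_boundD[OF assms(1)]) (use assms(4) in force, simp)
  also have "\<dots> \<le> C * C ^ length ws"
    using assms by (intro mult_left_mono prod_list_map_le) (auto dest: dq_bounded_norm)
  finally show ?thesis .
qed

lemma dq_bounded_zero: "dq_bounded h s D 0 (\<lambda>x y. 0)"
  by (induction s arbitrary: D) (simp_all add: dq_x_def dq_y_def)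

text \<open>Replacing the directions one by one turns the increment in the directions into a sum of
  values of the same form, each with one direction replaced by its difference quotient.\<close>

lemma dq_bounded_direction_increment:
  fixes f :: "'a::real_normed_vector \<Rightarrow> 'b::real_normed_vector"
  assumes f: "C_infinity f" and "h \<noteq> 0"
    and IH: "\<And>ws'. length ws' = j \<Longrightarrow> (\<And>w. w \<in> set ws' \<Longrightarrow> dq_bounded h s E C w) \<Longrightarrow>
      dq_bounded h s E B (comp_deriv f ws' v)"
    and "length xs + length ws = j"
    and "\<And>w. w \<in> set xs \<Longrightarrow> dq_bounded h s E C w"
    and "\<And>w. w \<in> set ws \<Longrightarrow> dq_bounded h s E C w"
    and "\<And>w. w \<in> set ws \<Longrightarrow> dq_bounded h s E C (dq_x h w)"
    and "\<And>w. w \<in> set ws \<Longrightarrow> dq_bounded h s E C (\<lambda>x y. w (x + h) y)"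
    and "0 \<le> B"
  shows "dq_bounded h s E (real (length ws) * B) (\<lambda>x y. (1 / h) *\<^sub>R
     (comp_deriv f (xs @ map (\<lambda>w x y. w (x + h) y) ws) v x y - comp_deriv f (xs @ ws) v x y))"
  using assms(4-)
proof (induction ws arbitrary: xs)
  case Nil
  show ?case by (simp add: dq_bounded_zero)
next
  case (Cons w ws)
  let ?S = "map (\<lambda>w x y. w (x + h) y)"
  have 1: "dq_bounded h s E B (comp_deriv f (xs @ dq_x h w # ?S ws) v)"
    by (rule IH) (use Cons.prems in auto)
  have 2: "dq_bounded h s E (real (length ws) * B) (\<lambda>x y. (1 / h) *\<^sub>R
     (comp_deriv f ((xs @ [w]) @ ?S ws) v x y - comp_deriv f ((xs @ [w]) @ ws) v x y))"
    by (rule Cons.IH) (use Cons.prems in auto)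
  have eq: "comp_deriv f (xs @ dq_x h w # ?S ws) v x y =
     (1 / h) *\<^sub>R (comp_deriv f (xs @ ?S (w # ws)) v x y - comp_deriv f ((xs @ [w]) @ ?S ws) v x y)" for x y
    by (simp add: dq_x_def iter_deriv_scaleR[OF f] iter_deriv_diff[OF f])
  show ?case
    using dq_bounded_add[OF 1 2] unfolding eq
    by (simp add: algebra_simps del: map_append)
qed

text \<open>Interpolation leaves the set of values but not its convex hull. Derivative bounds on
  \<open>hull_of D u\<close> therefore hold again, with the same constant, for the interpolated base
  point, and the induction hypothesis applies to it.\<close>

lemma hull_of_segment:
  assumes "t \<in> {0..1}"
  shows "hull_of (dom_x h D) (\<lambda>x y. (1 - t) *\<^sub>R u x y + t *\<^sub>R u (x + h) y) \<subseteq> hull_of D u"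
proof (rule hull_minimal)
  show "case_prod (\<lambda>x y. (1 - t) *\<^sub>R u x y + t *\<^sub>R u (x + h) y) ` dom_x h D \<subseteq> hull_of D u"
  proof clarify
    fix x y assume "(x, y) \<in> dom_x h D"
    then have "u x y \<in> hull_of D u" "u (x + h) y \<in> hull_of D u"
      by (auto simp: dom_x_def intro: hull_inc image_eqI[of _ _ "(x, y)"] image_eqI[of _ _ "(x + h, y)"])
    then show "(1 - t) *\<^sub>R u x y + t *\<^sub>R u (x + h) y \<in> hull_of D u"
      using assms convex_convex_hull by (intro convexD) auto
  qed
qed simp

lemma dq_bounded_segment:
  assumes "dq_bounded h s D C u" "t \<in> {0..1}"
  shows "dq_bounded h s (dom_x h D) C (\<lambda>x y. (1 - t) *\<^sub>R u x y + t *\<^sub>R u (x + h) y)"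
proof -
  have 1: "dq_bounded h s (dom_x h D) C u"
    using assms(1) by (rule dq_bounded_mono) (auto simp: dom_x_def)
  have 2: "dq_bounded h s (dom_x h D) C (\<lambda>x y. u (x + h) y)"
    using assms(1) by (rule dq_bounded_shift) (auto simp: dom_x_def)
  have "\<bar>1 - t\<bar> * C + \<bar>t\<bar> * C = C" using assms(2) by (simp add: algebra_simps)
  then show ?thesis
    using dq_bounded_add[OF dq_bounded_scaleR[OF 1, of "1 - t"] dq_bounded_scaleR[OF 2, of t]] by simp
qed

text \<open>Differentiating along the segment from u(x, y) to u(x + h, y) puts the increment of
  \<open>u\<close> into a new head slot; by homogeneity of that slot the factor 1 / h turns it into
  \<open>dq_x h u\<close>.\<close>

lemma dq_bounded_point_increment:
  fixes f :: "'a::real_normed_vector \<Rightarrow> 'b::real_normed_vector"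
  assumes f: "C_infinity f" and h: "h \<noteq> 0"
    and "\<And>t. t \<in> {0..1} \<Longrightarrow> dq_bounded h s E B
      (comp_deriv f (dq_x h u # ws) (\<lambda>x y. (1 - t) *\<^sub>R u x y + t *\<^sub>R u (x + h) y))"
  shows "dq_bounded h s E B (\<lambda>x y. (1 / h) *\<^sub>R
     (comp_deriv f ws (\<lambda>x y. u (x + h) y) x y - comp_deriv f ws u x y))"
proof -
  let ?p = "\<lambda>t x y. (1 / h) *\<^sub>R iter_deriv f (map (\<lambda>w. w x y) ws) ((1 - t) *\<^sub>R u x y + t *\<^sub>R u (x + h) y)"
  have "dq_bounded h s E B (\<lambda>x y. ?p 1 x y - ?p 0 x y)"
  proof (rule dq_bounded_mvt[where p = ?p])
    fix x y t
    have "((\<lambda>t. ?p t x y) has_vector_derivative (1 / h) *\<^sub>R iter_deriv f ((u (x + h) y - u x y) # map (\<lambda>w. w x y) ws)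
        ((1 - t) *\<^sub>R u x y + t *\<^sub>R u (x + h) y)) (at t within {0..1})"
      by (intro bounded_linear.has_vector_derivative[OF bounded_linear_scaleR_right] iter_deriv_segment f)
    then show "((\<lambda>t. ?p t x y) has_vector_derivative
       comp_deriv f (dq_x h u # ws) (\<lambda>x y. (1 - t) *\<^sub>R u x y + t *\<^sub>R u (x + h) y) x y) (at t within {0..1})"
      using iter_deriv_scaleR[OF f, of "[]" "1 / h" _ "map (\<lambda>w. w x y) ws"] by (simp add: dq_x_def)
  qed (rule assms(3))
  then show ?thesis by (simp add: scaleR_diff_right)
qed

text \<open>Discrete product rule: the directions are moved first, with the base point already
  shifted, and then the base point, with the directions unshifted. The two parts yield the two
  summands of the constant.\<close>

lemma dq_bounded_comp_deriv_step:
  fixes f :: "'a::real_normed_vector \<Rightarrow> 'b::real_normed_vector"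
  assumes f: "C_infinity f" and h: "h \<noteq> 0" and C: "0 \<le> C"
    and IH: "\<And>(u::real \<Rightarrow> real \<Rightarrow> 'a) ws D.
      deriv_bound f (s + length ws) (hull_of D u) C \<Longrightarrow> dq_bounded h s D C u \<Longrightarrow>
      (\<And>w. w \<in> set ws \<Longrightarrow> dq_bounded h s D C w) \<Longrightarrow>
      dq_bounded h s D (chain_const C s (length ws)) (comp_deriv f ws u)"
    and db: "deriv_bound f (Suc s + length ws) (hull_of D u) C"
    and u: "dq_bounded h (Suc s) D C u"
    and ws: "\<And>w. w \<in> set ws \<Longrightarrow> dq_bounded h (Suc s) D C w"
  shows "dq_bounded h s (dom_x h D)
    (real (length ws) * chain_const C s (length ws) + chain_const C s (Suc (length ws)))
    (dq_x h (comp_deriv f ws u))"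
proof -
  let ?E = "dom_x h D"
  have lower: "dq_bounded h s ?E C v" "dq_bounded h s ?E C (dq_x h v)" "dq_bounded h s ?E C (\<lambda>x y. v (x + h) y)"
    if "dq_bounded h (Suc s) D C v" for v :: "real \<Rightarrow> real \<Rightarrow> 'a"
    using that dq_bounded_mono[OF that dom_subset(1), where C' = C and s' = s]
      dq_bounded_shift[OF dq_bounded_mono[OF that order_refl, where C' = C and s' = s], where D' = "dom_x h D"]
    by (auto simp: dom_x_def)
  have hull1: "hull_of ?E (\<lambda>x y. u (x + h) y) \<subseteq> hull_of D u"
    using hull_of_segment[where t = 1 and h = h and D = D and u = u] by simp
  have 1: "dq_bounded h s ?E (real (length ws) * chain_const C s (length ws)) (\<lambda>x y. (1 / h) *\<^sub>R
     (comp_deriv f ([] @ map (\<lambda>w x y. w (x + h) y) ws) (\<lambda>x y. u (x + h) y) x y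
       - comp_deriv f ([] @ ws) (\<lambda>x y. u (x + h) y) x y))"
  proof (rule dq_bounded_direction_increment[OF f h, where C = C and j = "length ws"])
    fix ws' :: "(real \<Rightarrow> real \<Rightarrow> 'a) list"
    assume ws': "length ws' = length ws" "\<And>w. w \<in> set ws' \<Longrightarrow> dq_bounded h s ?E C w"
    show "dq_bounded h s ?E (chain_const C s (length ws)) (comp_deriv f ws' (\<lambda>x y. u (x + h) y))"
      unfolding ws'(1)[symmetric]
      by (rule IH) (use ws' lower[OF u] deriv_bound_mono[OF db _ hull1] in auto)
  qed (use lower[OF ws] chain_const_nonneg[OF C] in auto)
  have 2: "dq_bounded h s ?E (chain_const C s (Suc (length ws))) (\<lambda>x y. (1 / h) *\<^sub>R
     (comp_deriv f ws (\<lambda>x y. u (x + h) y) x y - comp_deriv f ws u x y))"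
  proof (rule dq_bounded_point_increment[OF f h])
    fix t :: real assume t: "t \<in> {0..1}"
    have "dq_bounded h s ?E (chain_const C s (length (dq_x h u # ws)))
      (comp_deriv f (dq_x h u # ws) (\<lambda>x y. (1 - t) *\<^sub>R u x y + t *\<^sub>R u (x + h) y))"
      by (rule IH)
        (use dq_bounded_segment[OF dq_bounded_mono[OF u order_refl order_refl, of s] t]
          deriv_bound_mono[OF db _ hull_of_segment[OF t]] lower[OF u] lower(1)[OF ws] in auto)
    then show "dq_bounded h s ?E (chain_const C s (Suc (length ws)))
      (comp_deriv f (dq_x h u # ws) (\<lambda>x y. (1 - t) *\<^sub>R u x y + t *\<^sub>R u (x + h) y))" by simp
  qed
  have "dq_x h (comp_deriv f ws u) = (\<lambda>x y.
     (1 / h) *\<^sub>R (comp_deriv f ([] @ map (\<lambda>w x y. w (x + h) y) ws) (\<lambda>x y. u (x + h) y) x y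
       - comp_deriv f ([] @ ws) (\<lambda>x y. u (x + h) y) x y) +
     (1 / h) *\<^sub>R (comp_deriv f ws (\<lambda>x y. u (x + h) y) x y - comp_deriv f ws u x y))"
    by (simp add: dq_x_def comp_def algebra_simps fun_eq_iff)
  with dq_bounded_add[OF 1 2] show ?thesis by simp
qed

lemma dq_bounded_comp_deriv:
  fixes f :: "'a::real_normed_vector \<Rightarrow> 'b::real_normed_vector"
  assumes f: "C_infinity f" and h: "h \<noteq> 0" and C: "0 \<le> C"
    and "deriv_bound f (s + length ws) (hull_of D u) C"
    and "dq_bounded h s D C u" and "\<And>w. w \<in> set ws \<Longrightarrow> dq_bounded h s D C w"
  shows "dq_bounded h s D (chain_const C s (length ws)) (comp_deriv f ws u)"
  using assms(4-)
proof (induction s arbitrary: D u ws)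
  case 0
  have "deriv_bound f (length ws) (case_prod u ` D) C"
    using 0(1) by (rule deriv_bound_mono) (auto intro: hull_subset[THEN subsetD])
  from comp_deriv_bound_0[OF this C 0(3)] show ?case by simp
next
  case (Suc s)
  let ?b = "real (length ws) * chain_const C s (length ws) + chain_const C s (Suc (length ws))"
  have "deriv_bound f (length ws) (case_prod u ` D) C"
    using Suc.prems(1) by (rule deriv_bound_mono) (auto intro: hull_subset[THEN subsetD])
  note 0 = comp_deriv_bound_0[OF this C Suc.prems(3)]
  have x: "dq_bounded h s (dom_x h D) ?b (dq_x h (comp_deriv f ws u))"
    by (rule dq_bounded_comp_deriv_step[OF f h C Suc.IH Suc.prems])
  \<comment> \<open>The y-quotient is the x-quotient of the functions with exchanged arguments; the
    set of values, and with it the derivative bound, is unchanged.\<close>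
  let ?flip = "\<lambda>(u::real \<Rightarrow> real \<Rightarrow> 'a) x y. u y x"
  have hull: "case_prod (?flip u) ` prod.swap ` D = case_prod u ` D"
    unfolding image_image by (rule image_cong) auto
  have "dq_bounded h s (dom_x h (prod.swap ` D))
      (real (length (map ?flip ws)) * chain_const C s (length (map ?flip ws)) +
        chain_const C s (Suc (length (map ?flip ws))))
      (dq_x h (comp_deriv f (map ?flip ws) (?flip u)))"
  proof (rule dq_bounded_comp_deriv_step[OF f h C Suc.IH])
    show "deriv_bound f (Suc s + length (map ?flip ws)) (hull_of (prod.swap ` D) (?flip u)) C"
      unfolding hull using Suc.prems(1) by simp
    show "dq_bounded h (Suc s) (prod.swap ` D) C (?flip u)"
      using Suc.prems(2) by (rule dq_bounded_flipI)
    show "dq_bounded h (Suc s) (prod.swap ` D) C w" if "w \<in> set (map ?flip ws)" for w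
    proof -
      from that obtain v where "v \<in> set ws" "w = ?flip v" by auto
      then show ?thesis using dq_bounded_flipI[OF Suc.prems(3)] by blast
    qed
  qed
  then have "dq_bounded h s (dom_x h (prod.swap ` D)) ?b (dq_x h (\<lambda>x y. comp_deriv f ws u y x))"
    by (simp add: comp_def)
  then have y: "dq_bounded h s (dom_y h D) ?b (dq_y h (comp_deriv f ws u))"
    unfolding dom_x_swap dq_x_flip[of h "comp_deriv f ws u"]
    using dq_bounded_flipI[of h s "prod.swap ` dom_y h D" ?b "\<lambda>x y. dq_y h (comp_deriv f ws u) y x"]
    by (simp add: image_image)
  have c: "?b \<le> chain_const C (Suc s) (length ws)"
    "C * C ^ length ws \<le> chain_const C (Suc s) (length ws)"
    using C by (auto intro!: add_nonneg_nonneg mult_nonneg_nonneg chain_const_nonneg)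
  show ?case
    unfolding dq_bounded.simps
    using dq_bounded_mono[OF x order_refl c(1) order_refl] dq_bounded_mono[OF y order_refl c(1) order_refl]
      0 c(2) by (blast intro: order_trans)
qed

text \<open>The point is linearity in \<open>L\<close>. The direction is divided by
  \<open>L\<close>, so that its quotients are at most 1 and hence at most \<open>C\<close>; the
  chain rule constant is then free of \<open>L\<close>, and homogeneity of the slot puts the factor
  back.\<close>

lemma dq_bounded_compose_dq_x:
  fixes f :: "'a::real_normed_vector \<Rightarrow> 'b::real_normed_vector"
  assumes f: "C_infinity f" and h: "h \<noteq> 0" and C: "1 \<le> C"
    and db: "deriv_bound f (Suc s) (hull_of D u) C"
    and u: "dq_bounded h s D C u" and "0 < L" and dx: "dq_bounded h s (dom_x h D) L (dq_x h u)"
  shows "dq_bounded h s (dom_x h D) (chain_const C s 1 * L) (dq_x h (\<lambda>x y. f (u x y)))"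
proof -
  let ?E = "dom_x h D"
  let ?w = "\<lambda>x y. (1 / L) *\<^sub>R dq_x h u x y"
  have w: "dq_bounded h s ?E C ?w"
    using dq_bounded_mono[OF dq_bounded_scaleR[OF dx, of "1 / L"] order_refl _ order_refl, of C] C \<open>0 < L\<close>
    by simp
  have "dq_bounded h s ?E (chain_const C s 1 * L) (\<lambda>x y. (1 / h) *\<^sub>R
     (comp_deriv f [] (\<lambda>x y. u (x + h) y) x y - comp_deriv f [] u x y))"
  proof (rule dq_bounded_point_increment[OF f h])
    fix t :: real assume t: "t \<in> {0..1}"
    let ?u = "\<lambda>x y. (1 - t) *\<^sub>R u x y + t *\<^sub>R u (x + h) y"
    have "dq_bounded h s ?E (chain_const C s (length [?w])) (comp_deriv f [?w] ?u)"
      by (rule dq_bounded_comp_deriv[OF f h])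
        (use C w deriv_bound_mono[OF db _ hull_of_segment[OF t]] dq_bounded_segment[OF u t] in auto)
    from dq_bounded_scaleR[OF this, of L]
    show "dq_bounded h s ?E (chain_const C s 1 * L) (comp_deriv f [dq_x h u] ?u)"
      using \<open>0 < L\<close> iter_deriv_scaleR[OF f, of "[]" "1 / L" _ "[]"] by (simp add: mult.commute)
  qed
  then show ?thesis by (simp add: dq_x_def)
qed

section \<open>Derivatives on compact sets and values on the grids\<close>

lemma iter_deriv_locally_close:
  fixes f :: "'a::real_normed_vector \<Rightarrow> 'b::real_normed_vector"
  assumes "C_k k f" "j \<le> k"
  obtains d where "d > 0"
    "\<And>w vs. dist w z < d \<Longrightarrow> vs \<in> unit_lists j \<Longrightarrow> dist (iter_deriv f vs w) (iter_deriv f vs z) < 1"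
proof -
  have "\<forall>\<^sub>F w in at z. \<forall>vs\<in>unit_lists j. dist (iter_deriv f vs w) (iter_deriv f vs z) < 1"
    using assms unfolding C_k_def by (intro uniform_limitD) auto
  then obtain d where d: "d > 0"
    "\<And>w. w \<noteq> z \<Longrightarrow> dist w z < d \<Longrightarrow> \<forall>vs\<in>unit_lists j. dist (iter_deriv f vs w) (iter_deriv f vs z) < 1"
    unfolding eventually_at by blast
  show ?thesis
  proof (rule that[OF d(1)])
    fix w and vs :: "'a list" assume "dist w z < d" "vs \<in> unit_lists j"
    then show "dist (iter_deriv f vs w) (iter_deriv f vs z) < 1"
      using d(2)[of w] by (cases "w = z") auto
  qed
qed

text \<open>Near \<open>z\<close> the increments of \<open>D\<^sup>jf\<close> are bounded and \<open>D\<^sup>j\<^sup>+\<^sup>1f\<close> is uniformly close to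
  \<open>D\<^sup>j\<^sup>+\<^sup>1f(z)\<close>, so the mean value inequality bounds the latter.\<close>

lemma iter_deriv_bounded_at:
  assumes "C_k k f" "j \<le> k"
  shows "\<exists>B. \<forall>vs\<in>unit_lists j. norm (iter_deriv f vs z) \<le> B"
  using assms(2)
proof (induction j)
  case 0
  show ?case by (auto simp: unit_lists_def)
next
  case (Suc j)
  then have "j < k" "j \<le> k" by simp_all
  from Suc.IH[OF \<open>j \<le> k\<close>] obtain B where B: "\<And>vs. vs \<in> unit_lists j \<Longrightarrow> norm (iter_deriv f vs z) \<le> B" by blast
  obtain d1 where d1: "d1 > 0"
    "\<And>w vs. dist w z < d1 \<Longrightarrow> vs \<in> unit_lists j \<Longrightarrow> dist (iter_deriv f vs w) (iter_deriv f vs z) < 1"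
    using iter_deriv_locally_close[OF assms(1) \<open>j \<le> k\<close>] by blast
  obtain d2 where d2: "d2 > 0"
    "\<And>w vs. dist w z < d2 \<Longrightarrow> vs \<in> unit_lists (Suc j) \<Longrightarrow> dist (iter_deriv f vs w) (iter_deriv f vs z) < 1"
    using iter_deriv_locally_close[OF assms(1) Suc.prems] by blast
  define d where "d = min d1 d2 / 2"
  have d: "d > 0" "d < d1" "d < d2" using d1(1) d2(1) by (auto simp: d_def)
  have "norm (iter_deriv f us z) \<le> (1 + d) / d" if us: "us \<in> unit_lists (Suc j)" for us
  proof -
    obtain v vs where vs: "us = v # vs" "vs \<in> unit_lists j" "norm v \<le> 1"
      using us by (auto simp: unit_lists_def length_Suc_conv)
    let ?D = "\<lambda>w. frechet_derivative (iter_deriv f vs) (at w)"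
    have D: "(iter_deriv f vs has_derivative ?D w) (at w)" for w
      using assms(1) vs(2) \<open>j < k\<close> frechet_derivative_works
      unfolding C_k_def unit_lists_def by blast
    have near: "dist (z + (t * d) *\<^sub>R v) z \<le> d" if "t \<in> {0..1}" for t
    proof -
      have "t * (d * norm v) \<le> 1 * (d * 1)"
        using that d vs(3) by (intro mult_mono) auto
      then show ?thesis using that d by (simp add: dist_norm abs_mult)
    qed
    have "norm ((iter_deriv f vs (z + (1 * d) *\<^sub>R v) - (1 * d) *\<^sub>R iter_deriv f us z) -
      (iter_deriv f vs (z + (0 * d) *\<^sub>R v) - (0 * d) *\<^sub>R iter_deriv f us z)) \<le> d"
    proof (rule norm_mvt[where p = "\<lambda>t. iter_deriv f vs (z + (t * d) *\<^sub>R v) - (t * d) *\<^sub>R iter_deriv f us z"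
          and p' = "\<lambda>t. d *\<^sub>R ?D (z + (t * d) *\<^sub>R v) v - d *\<^sub>R iter_deriv f us z"])
      fix t :: real assume t: "t \<in> {0..1}"
      have 1: "((\<lambda>t. z + (t * d) *\<^sub>R v) has_vector_derivative d *\<^sub>R v) (at t within {0..1})"
        unfolding has_vector_derivative_def by (auto intro!: derivative_eq_intros)
      have 2: "((\<lambda>t. (t * d) *\<^sub>R iter_deriv f us z) has_vector_derivative d *\<^sub>R iter_deriv f us z) (at t within {0..1})"
        unfolding has_vector_derivative_def by (auto intro!: derivative_eq_intros)
      have "((\<lambda>t. iter_deriv f vs (z + (t * d) *\<^sub>R v)) has_vector_derivative ?D (z + (t * d) *\<^sub>R v) (d *\<^sub>R v))
          (at t within {0..1})"
        using vector_derivative_diff_chain_within[OF 1 has_derivative_at_withinI[OF D]]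
        by (simp add: comp_def)
      then have 3: "((\<lambda>t. iter_deriv f vs (z + (t * d) *\<^sub>R v)) has_vector_derivative d *\<^sub>R ?D (z + (t * d) *\<^sub>R v) v)
          (at t within {0..1})"
        by (simp add: linear_cmul[OF has_derivative_linear[OF D]])
      show "((\<lambda>t. iter_deriv f vs (z + (t * d) *\<^sub>R v) - (t * d) *\<^sub>R iter_deriv f us z) has_vector_derivative
          d *\<^sub>R ?D (z + (t * d) *\<^sub>R v) v - d *\<^sub>R iter_deriv f us z) (at t within {0..1})"
        by (rule has_vector_derivative_diff[OF 3 2])
      have "norm (iter_deriv f us (z + (t * d) *\<^sub>R v) - iter_deriv f us z) < 1"
        using d2(2)[OF _ us] near[OF t] d(3) by (simp add: dist_norm)
      then show "norm (d *\<^sub>R ?D (z + (t * d) *\<^sub>R v) v - d *\<^sub>R iter_deriv f us z) \<le> d"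
        using d(1) vs(1) by (simp flip: scaleR_diff_right)
    qed
    moreover have "norm (iter_deriv f vs (z + d *\<^sub>R v) - iter_deriv f vs z) < 1"
      using d1(2)[OF _ vs(2), of "z + d *\<^sub>R v"] near[of 1] d(2) by (simp add: dist_norm)
    moreover have "iter_deriv f vs (z + (1 * d) *\<^sub>R v) - (1 * d) *\<^sub>R iter_deriv f us z -
      (iter_deriv f vs (z + (0 * d) *\<^sub>R v) - (0 * d) *\<^sub>R iter_deriv f us z) =
      (iter_deriv f vs (z + d *\<^sub>R v) - iter_deriv f vs z) - d *\<^sub>R iter_deriv f us z"
      by simp
    ultimately have "norm (iter_deriv f vs (z + d *\<^sub>R v) - iter_deriv f vs z) < 1"
      "norm ((iter_deriv f vs (z + d *\<^sub>R v) - iter_deriv f vs z) - d *\<^sub>R iter_deriv f us z) \<le> d"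
      by (simp_all add: algebra_simps)
    then have "norm (d *\<^sub>R iter_deriv f us z) \<le> 1 + d"
      using norm_triangle_sub[of "d *\<^sub>R iter_deriv f us z" "iter_deriv f vs (z + d *\<^sub>R v) - iter_deriv f vs z"]
        norm_minus_commute[of "d *\<^sub>R iter_deriv f us z" "iter_deriv f vs (z + d *\<^sub>R v) - iter_deriv f vs z"]
      by linarith
    then show ?thesis using d(1) by (simp add: field_simps)
  qed
  then show ?case by blast
qed

text \<open>The directions may range over a noncompact ball, so only the base point is covered: the
  bound at a point spreads to a ball because continuity is uniform in the directions, and finitely
  many balls cover \<open>K\<close>.\<close>

lemma iter_deriv_bounded_compact:
  assumes "C_k k f" "j \<le> k" "compact K"
  shows "\<exists>B. \<forall>z\<in>K. \<forall>vs\<in>unit_lists j. norm (iter_deriv f vs z) \<le> B"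
proof -
  have "\<exists>d B. d > 0 \<and> (\<forall>w vs. w \<in> ball z d \<longrightarrow> vs \<in> unit_lists j \<longrightarrow> norm (iter_deriv f vs w) \<le> B)" for z
  proof -
    obtain d where d: "d > 0"
      "\<And>w vs. dist w z < d \<Longrightarrow> vs \<in> unit_lists j \<Longrightarrow> dist (iter_deriv f vs w) (iter_deriv f vs z) < 1"
      using iter_deriv_locally_close[OF assms(1,2)] by blast
    obtain B where B: "\<And>vs. vs \<in> unit_lists j \<Longrightarrow> norm (iter_deriv f vs z) \<le> B"
      using iter_deriv_bounded_at[OF assms(1,2)] by blast
    have "norm (iter_deriv f vs w) \<le> B + 1" if "w \<in> ball z d" "vs \<in> unit_lists j" for w vs
      using d(2)[OF _ that(2), of w] that B[OF that(2)]
        norm_triangle_ineq2[of "iter_deriv f vs w" "iter_deriv f vs z"]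
      by (auto simp: dist_norm norm_minus_commute)
    with d(1) show ?thesis by blast
  qed
  then obtain d B where d: "\<And>z. d z > 0"
    and B: "\<And>z w vs. w \<in> ball z (d z) \<Longrightarrow> vs \<in> unit_lists j \<Longrightarrow> norm (iter_deriv f vs w) \<le> B z"
    by metis
  obtain Z where Z: "Z \<subseteq> K" "finite Z" "K \<subseteq> (\<Union>z\<in>Z. ball z (d z))"
    by (rule compactE_image[OF assms(3), of K "\<lambda>z. ball z (d z)"]) (use d in force)+
  have "norm (iter_deriv f vs w) \<le> (\<Sum>z\<in>Z. \<bar>B z\<bar>)" if "w \<in> K" "vs \<in> unit_lists j" for w vs
  proof -
    obtain z where z: "z \<in> Z" "w \<in> ball z (d z)"
      using subsetD[OF Z(3) \<open>w \<in> K\<close>] by (rule UN_E)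
    have "norm (iter_deriv f vs w) \<le> \<bar>B z\<bar>" using B[OF z(2) that(2)] by linarith
    also have "\<dots> \<le> (\<Sum>z\<in>Z. \<bar>B z\<bar>)" using z(1) Z(2) by (intro member_le_sum) auto
    finally show ?thesis .
  qed
  then show ?thesis by blast
qed

lemma iter_deriv_sgn:
  assumes "C_infinity f"
  shows "iter_deriv f (xs @ vs) z = prod_list (map norm vs) *\<^sub>R iter_deriv f (xs @ map sgn vs) z"
proof (induction vs arbitrary: xs)
  case (Cons v vs)
  have "iter_deriv f (xs @ v # vs) z = prod_list (map norm vs) *\<^sub>R iter_deriv f (xs @ v # map sgn vs) z"
    using Cons[of "xs @ [v]"] by simp
  also have "iter_deriv f (xs @ v # map sgn vs) z = norm v *\<^sub>R iter_deriv f (xs @ sgn v # map sgn vs) z"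
    using iter_deriv_scaleR[OF assms, of xs "norm v" "sgn v" "map sgn vs" z]
    by (cases "v = 0") (simp_all add: sgn_div_norm)
  finally show ?case by (simp add: mult.commute)
qed simp

lemma deriv_boundI:
  assumes "C_infinity f"
    and "\<And>j z vs. j \<le> n \<Longrightarrow> z \<in> K \<Longrightarrow> vs \<in> unit_lists j \<Longrightarrow> norm (iter_deriv f vs z) \<le> C"
  shows "deriv_bound f n K C"
  unfolding deriv_bound_def
proof (intro ballI allI impI)
  fix z and vs :: "'a list" assume "z \<in> K" "length vs \<le> n"
  then have "norm (iter_deriv f (map sgn vs) z) \<le> C"
    by (intro assms(2)) (auto simp: unit_lists_def norm_sgn)
  moreover have "0 \<le> prod_list (map norm vs)" by (induction vs) auto
  ultimately show "norm (iter_deriv f vs z) \<le> C * prod_list (map norm vs)"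
    using iter_deriv_sgn[OF assms(1), of "[]" vs z] by (simp add: mult.commute[of C] mult_left_mono)
qed

text \<open>Bounds for the limit \<open>f\<close> pass to \<open>F h\<close> by uniform convergence
  on \<open>K\<close>. The homogeneity that extends them from unit directions to all directions
  comes from the smoothness of \<open>F h\<close>.\<close>

lemma eventually_deriv_bound:
  assumes f: "C_k n f" and lim: "C_k_limit n F f (at 0 within mesh e0)"
    and F: "\<And>h. h \<in> mesh e0 \<Longrightarrow> C_infinity (F h)" and K: "compact K"
  shows "\<exists>C. \<forall>\<^sub>F h in at 0 within mesh e0. deriv_bound (F h) n K C"
proof -
  have "\<forall>j. \<exists>B. j \<le> n \<longrightarrow> (\<forall>z\<in>K. \<forall>vs\<in>unit_lists j. norm (iter_deriv f vs z) \<le> B)"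
    using iter_deriv_bounded_compact[OF f _ K] by blast
  then obtain B where B: "\<And>j z vs. j \<le> n \<Longrightarrow> z \<in> K \<Longrightarrow> vs \<in> unit_lists j \<Longrightarrow> norm (iter_deriv f vs z) \<le> B j"
    by metis
  \<comment> \<open>The sum dominates the bounds of all orders at once; the 1 is the tolerance
    allowed between \<open>F h\<close> and \<open>f\<close>.\<close>
  define C where "C = (\<Sum>j\<le>n. \<bar>B j\<bar>) + 1"
  have C: "B j + 1 \<le> C" if "j \<le> n" for j
    using member_le_sum[of j "{..n}" "\<lambda>j. \<bar>B j\<bar>"] that by (auto simp: C_def)
  have "\<forall>\<^sub>F h in at 0 within mesh e0. \<forall>j\<in>{..n}. \<forall>p\<in>K \<times> unit_lists j.
      dist ((\<lambda>(z, vs). iter_deriv (F h) vs z) p) ((\<lambda>(z, vs). iter_deriv f vs z) p) < 1"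
    by (intro eventually_ball_finite ballI uniform_limitD)
      (use lim K in \<open>auto simp: C_k_limit_def\<close>)
  moreover have "\<forall>\<^sub>F h in at 0 within mesh e0. h \<in> mesh e0"
    by (auto simp: eventually_at_filter)
  ultimately have "\<forall>\<^sub>F h in at 0 within mesh e0. deriv_bound (F h) n K C"
  proof eventually_elim
    case (elim h)
    show ?case
    proof (rule deriv_boundI[OF F[OF elim(2)]])
      fix j z and vs :: "'a list" assume *: "j \<le> n" "z \<in> K" "vs \<in> unit_lists j"
      then have "dist (iter_deriv (F h) vs z) (iter_deriv f vs z) < 1" using elim(1) by auto
      then show "norm (iter_deriv (F h) vs z) \<le> C"
        using B[OF *] C[OF *(1)] norm_triangle_ineq2[of "iter_deriv (F h) vs z" "iter_deriv f vs z"]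
        by (simp add: dist_norm)
    qed
  qed
  then show ?thesis by blast
qed

section \<open>Mesh sizes and grids\<close>

lemma mesh_pos: "h \<in> mesh e0 \<Longrightarrow> 0 < h"
  by (auto simp: mesh_def)

text \<open>Dyadic mesh sizes accumulate only at 0. Coarse meshes thus contribute finitely many grid
  values, which makes total boundedness over all meshes possible.\<close>

lemma finite_mesh_ge:
  assumes "0 < d"
  shows "finite {h \<in> mesh e0. d \<le> h}"
proof -
  obtain n where n: "(1 / 2) ^ n < d"
    using real_arch_pow_inv[OF assms, of "1 / 2"] by auto
  have "{h \<in> mesh e0. d \<le> h} \<subseteq> (\<lambda>j. (1 / 2) ^ j) ` {..n}"
  proof
    fix h assume "h \<in> {h \<in> mesh e0. d \<le> h}"
    then obtain j where j: "h = (1 / 2) ^ j" "d \<le> h" by (auto simp: mesh_def power_one_over)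
    have "j \<le> n"
    proof (rule ccontr)
      assume "\<not> j \<le> n"
      then have "(1 / 2 :: real) ^ j \<le> (1 / 2) ^ n" by (intro power_decreasing) auto
      with n j show False by simp
    qed
    with j show "h \<in> (\<lambda>j. (1 / 2) ^ j) ` {..n}" by auto
  qed
  then show ?thesis by (rule finite_subset) simp
qed

text \<open>Needed to pass inequalities to the limit along the mesh sizes, which is meaningless for
  a trivial filter.\<close>

lemma mesh_at_0_nontrivial:
  assumes "0 < e0"
  shows "at 0 within mesh e0 \<noteq> bot"
  unfolding trivial_limit_within islimpt_approachable
proof (intro notI, elim notE, intro allI impI)
  fix d :: real assume "0 < d"
  obtain n where n: "(1 / 2) ^ n < min d e0"
    using real_arch_pow_inv[of "min d e0" "1 / 2"] \<open>0 < d\<close> assms by auto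
  have "(1 / 2 :: real) ^ Suc n \<le> (1 / 2) ^ n" by simp
  with n have "(1 / 2 :: real) ^ Suc n < min d e0" by linarith
  then show "\<exists>x'\<in>mesh e0. x' \<noteq> 0 \<and> dist x' 0 < d"
    by (intro bexI[of _ "(1 / 2) ^ Suc n"]) (auto simp: mesh_def power_one_over intro!: exI[of _ "Suc n"])
qed

lemma grid_iff_nat:
  assumes "0 < h"
  shows "x \<in> grid h r \<longleftrightarrow> (\<exists>i::nat. x = real i * h \<and> real i * h \<le> r)"
proof
  assume "x \<in> grid h r"
  then obtain i :: int where i: "x = h * of_int i" "0 \<le> x" "x \<le> r" by (auto simp: grid_def)
  with assms have "0 \<le> i" by (simp add: zero_le_mult_iff)
  with i show "\<exists>i::nat. x = real i * h \<and> real i * h \<le> r"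
    by (intro exI[of _ "nat i"]) (simp add: mult.commute)
next
  assume "\<exists>i::nat. x = real i * h \<and> real i * h \<le> r"
  then obtain i :: nat where "x = real i * h" "real i * h \<le> r" by blast
  with assms show "x \<in> grid h r"
    by (auto simp: grid_def intro!: range_eqI[of _ _ "int i"])
qed

lemma grid_bounds: "x \<in> grid h r \<Longrightarrow> 0 \<le> x \<and> x \<le> r"
  by (auto simp: grid_def)

lemma grid_mono: "r \<le> r' \<Longrightarrow> grid h r \<subseteq> grid h r'"
  by (auto simp: grid_def)

lemma grid_add:
  assumes "0 < h" "x \<in> grid h r" "x + real i * h \<le> r'"
  shows "x + real i * h \<in> grid h r'"
proof -
  obtain n where "x = real n * h" using assms grid_iff_nat by blast
  with assms show ?thesis by (auto simp: grid_iff_nat intro!: exI[of _ "n + i"] simp: algebra_simps)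
qed

lemma finite_grid: "0 < h \<Longrightarrow> finite (grid h r)"
proof -
  assume h: "0 < h"
  have "grid h r \<subseteq> (\<lambda>i. real i * h) ` {..nat \<lfloor>r / h\<rfloor>}"
  proof
    fix x assume "x \<in> grid h r"
    then obtain i where "x = real i * h" "real i * h \<le> r" using grid_iff_nat[OF h] by blast
    then show "x \<in> (\<lambda>i. real i * h) ` {..nat \<lfloor>r / h\<rfloor>}"
      using h by (auto simp: le_nat_floor pos_le_divide_eq)
  qed
  then show ?thesis by (rule finite_subset) simp
qed

lemma grid_square_subset: "grid_square h r \<subseteq> square r"
  by (auto simp: grid_square_def square_def grid_def)

section \<open>Compactness of the grid values of all meshes together\<close>

lemma compact_square: "compact (square r)"
  by (auto simp: square_def intro!: compact_Times)

text \<open>Mazur's theorem, with total boundedness as hypothesis. The hull of a finite net of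
  \<open>S\<close> is compact and approximates the hull of \<open>S\<close>. The radius e / 3 is
  spent three times: from \<open>S\<close> to its net, in the net of the finite hull, and for the
  closure.\<close>

lemma compact_closure_convex_hull:
  fixes S :: "'a::banach set"
  assumes S: "\<And>e. e > 0 \<Longrightarrow> \<exists>T. finite T \<and> S \<subseteq> (\<Union>x\<in>T. ball x e)"
  shows "compact (closure (convex hull S))"
  unfolding compact_eq_totally_bounded complete_eq_closed
proof (intro conjI allI impI)
  fix e :: real assume "0 < e"
  then obtain T where T: "finite T" "S \<subseteq> (\<Union>x\<in>T. ball x (e / 3))"
    using S[of "e / 3"] by auto
  obtain N where N: "finite N" "convex hull T \<subseteq> (\<Union>x\<in>N. ball x (e / 3))"
    using finite_imp_compact_convex_hull[OF T(1)] \<open>0 < e\<close>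
    unfolding compact_eq_totally_bounded by (metis zero_less_divide_iff zero_less_numeral)
  \<comment> \<open>The thickening of the finite hull, written as a sum of convex sets: being
    convex, it contains the hull of \<open>S\<close> as soon as it contains
    \<open>S\<close>.\<close>
  let ?A = "\<Union>x\<in>convex hull T. \<Union>y\<in>ball 0 (e / 3). {x + y}"
  have "convex hull S \<subseteq> ?A"
  proof (rule hull_minimal)
    show "S \<subseteq> ?A"
    proof
      fix s assume "s \<in> S"
      then obtain t where t: "t \<in> T" "s \<in> ball t (e / 3)" using T by blast
      then show "s \<in> ?A"
        by (intro UN_I[of t] UN_I[of "s - t"]) (auto simp: hull_inc dist_norm norm_minus_commute)
    qed
  qed (intro convex_sums convex_convex_hull convex_ball)
  have "closure (convex hull S) \<subseteq> (\<Union>x\<in>N. ball x e)"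
  proof
    fix x assume "x \<in> closure (convex hull S)"
    then obtain y where y: "y \<in> convex hull S" "dist y x < e / 3"
      using \<open>0 < e\<close> unfolding closure_approachable by (meson zero_less_divide_iff zero_less_numeral)
    then obtain p q where pq: "p \<in> convex hull T" "q \<in> ball 0 (e / 3)" "y = p + q"
      using \<open>convex hull S \<subseteq> ?A\<close> by blast
    then obtain c where c: "c \<in> N" "dist c p < e / 3" using N by force
    have "dist p y < e / 3" using pq by (simp add: dist_norm)
    then have "dist c x < e"
      using c(2) y(2) dist_triangle[of c x p] dist_triangle[of p x y] by linarith
    with c(1) show "x \<in> (\<Union>x\<in>N. ball x e)" by auto
  qed
  with N(1) show "\<exists>k. finite k \<and> closure (convex hull S) \<subseteq> (\<Union>x\<in>k. ball x e)" by blast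
qed simp

text \<open>On fine meshes the values lie near the compact image of \<open>u\<close>; on the
  finitely many coarse meshes there are finitely many values. One set \<open>K\<close> thus serves
  every mesh.\<close>

lemma grid_values_in_compact_convex:
  fixes U :: "real \<Rightarrow> real \<Rightarrow> real \<Rightarrow> 'a::banach"
  assumes u: "continuous_on (square r) (case_prod u)"
    and close: "\<And>h x y. h \<in> mesh e0 \<Longrightarrow> (x, y) \<in> grid_square h r \<Longrightarrow> norm (U h x y - u x y) \<le> C * h"
  shows "\<exists>K. compact K \<and> (\<forall>h\<in>mesh e0. hull_of (grid_square h r) (U h) \<subseteq> K)"
proof -
  define S where "S = (\<Union>h\<in>mesh e0. case_prod (U h) ` grid_square h r)"
  have "compact (closure (convex hull S))"
  proof (rule compact_closure_convex_hull)
    fix e :: real assume e: "0 < e"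
    have "compact (case_prod u ` square r)"
      by (rule compact_continuous_image[OF u compact_square])
    then obtain T where T: "finite T" "case_prod u ` square r \<subseteq> (\<Union>x\<in>T. ball x (e / 2))"
      using e unfolding compact_eq_totally_bounded by (metis half_gt_zero)
    \<comment> \<open>Chosen so that the error is below e / 2 on meshes finer than \<open>d\<close>;
      the added 1 avoids a division by zero.\<close>
    define d where "d = e / (2 * (\<bar>C\<bar> + 1))"
    have d: "0 < d" using e by (simp add: d_def)
    let ?M = "{h \<in> mesh e0. d \<le> h}"
    let ?V = "\<Union>h\<in>?M. case_prod (U h) ` grid_square h r"
    have "finite ?V"
      using finite_mesh_ge[OF d] by (auto simp: grid_square_def mesh_pos finite_grid)
    moreover have "S \<subseteq> (\<Union>x\<in>T \<union> ?V. ball x e)"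
    proof
      fix s assume "s \<in> S"
      then obtain h x y where s: "h \<in> mesh e0" "(x, y) \<in> grid_square h r" "s = U h x y"
        by (auto simp: S_def)
      show "s \<in> (\<Union>x\<in>T \<union> ?V. ball x e)"
      proof (cases "d \<le> h")
        case True
        with s have "s \<in> ?V" by force
        then show ?thesis using e by (meson UN_I UnI2 centre_in_ball)
      next
        case False
        have "C * h \<le> (\<bar>C\<bar> + 1) * h" using mesh_pos[OF s(1)] by (intro mult_right_mono) auto
        also have "\<dots> < (\<bar>C\<bar> + 1) * d" using False by (intro mult_strict_left_mono) auto
        also have "\<dots> = e / 2" using abs_ge_zero[of C] by (simp add: d_def field_simps)
        finally have "dist (u x y) s < e / 2"
          using close[OF s(1,2)] s(3) by (simp add: dist_norm norm_minus_commute)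
        moreover obtain t where "t \<in> T" "dist t (u x y) < e / 2"
          using T(2) s(2) grid_square_subset by fastforce
        ultimately have "t \<in> T" "dist t s < e"
          using dist_triangle_half_l[of t "u x y" e s] by (auto simp: dist_commute)
        then show ?thesis by auto
      qed
    qed
    ultimately show "\<exists>T. finite T \<and> S \<subseteq> (\<Union>x\<in>T. ball x e)"
      using T(1) by (meson finite_UnI)
  qed
  moreover have "hull_of (grid_square h r) (U h) \<subseteq> closure (convex hull S)" if "h \<in> mesh e0" for h
    using hull_mono[of "case_prod (U h) ` grid_square h r" S convex] that closure_subset
    unfolding S_def by blast
  ultimately show ?thesis by blast
qed

section \<open>Bounds on the difference quotients of solutions\<close>

lemma funpow_dq_x_eq_dq:
  "(\<And>i. i \<le> m \<Longrightarrow> v (x + real i * h) y = p (x + real i * h)) \<Longrightarrow> (dq_x h ^^ m) v x y = (dq h ^^ m) p x"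
proof (induction m arbitrary: x)
  case 0
  then show ?case using 0[of 0] by simp
next
  case (Suc m)
  have "(dq_x h ^^ m) v x y = (dq h ^^ m) p x"
    by (rule Suc.IH) (use Suc.prems in auto)
  moreover have "(dq_x h ^^ m) v (x + h) y = (dq h ^^ m) p (x + h)"
    by (rule Suc.IH) (use Suc.prems[of "Suc _"] in \<open>auto simp: algebra_simps\<close>)
  ultimately show ?case
    by (simp add: dq_x_def[of h "(dq_x h ^^ m) v"] dq_def[of h "(dq h ^^ m) p"])
qed

lemma funpow_dq_x_cong:
  "(\<And>i. i \<le> m \<Longrightarrow> v (x + real i * h) y = w (x + real i * h) y) \<Longrightarrow>
    (dq_x h ^^ m) v x y = (dq_x h ^^ m) w x y"
  using funpow_dq_x_eq_dq[of m v x h y "\<lambda>x. w x y"] funpow_dq_x_eq_dq[of m w x h y "\<lambda>x. w x y"]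
  by simp

lemma dq_bounded_funpow_dq_x:
  "dq_bounded h s D C v \<Longrightarrow> m \<le> s \<Longrightarrow> (x, y) \<in> (dom_x h ^^ m) D \<Longrightarrow> norm ((dq_x h ^^ m) v x y) \<le> C"
proof (induction m arbitrary: s D v)
  case 0
  then show ?case by (auto intro: dq_bounded_norm)
next
  case (Suc m)
  then obtain t where t: "s = Suc t" "m \<le> t" by (cases s) auto
  with Suc.IH[of t "dom_x h D" "dq_x h v"] Suc.prems show ?case
    by (simp add: funpow_swap1)
qed

text \<open>The operators commute, so a quotient of order s + 1 that contains \<open>dq_y\<close> at
  all is an order s quotient of \<open>dq_y h v\<close>; only the pure x-quotient needs an estimate
  of its own.\<close>

lemma dq_bounded_SucI:
  "dq_bounded h s D C v \<Longrightarrow> dq_bounded h s (dom_y h D) C (dq_y h v) \<Longrightarrow>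
    (\<And>x y. (x, y) \<in> (dom_x h ^^ Suc s) D \<Longrightarrow> norm ((dq_x h ^^ Suc s) v x y) \<le> C) \<Longrightarrow>
    dq_bounded h (Suc s) D C v"
proof (induction s arbitrary: D v)
  case (Suc s)
  have "dq_bounded h (Suc s) (dom_x h D) C (dq_x h v)"
  proof (rule Suc.IH)
    show "dq_bounded h s (dom_x h D) C (dq_x h v)" using Suc.prems(1) by simp
    show "dq_bounded h s (dom_y h (dom_x h D)) C (dq_y h (dq_x h v))"
      using Suc.prems(2) by (simp add: dom_x_dom_y dq_y_dq_x)
    show "norm ((dq_x h ^^ Suc s) (dq_x h v) x y) \<le> C" if "(x, y) \<in> (dom_x h ^^ Suc s) (dom_x h D)" for x y
      using Suc.prems(3)[of x y] that unfolding funpow_Suc_right[of "Suc s"] comp_def .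
  qed
  with Suc.prems(2) dq_bounded_norm[OF Suc.prems(1)] show ?case
    unfolding dq_bounded.simps(2)[of h "Suc s"] by blast
qed auto

lemma dq_bounded_compose:
  fixes f :: "'a::real_normed_vector \<Rightarrow> 'b::real_normed_vector"
  assumes "C_infinity f" "h \<noteq> 0" "0 \<le> C" "deriv_bound f s (hull_of D u) C" "dq_bounded h s D C u"
  shows "dq_bounded h s D (chain_const C s 0) (\<lambda>x y. f (u x y))"
  using dq_bounded_comp_deriv[OF assms(1-3), where s = s and ws = "[]" and D = D and u = u] assms(4,5) by simp

text \<open>Gronwall needs the top quotient of f(u) at one point in terms of the top quotient of
  \<open>u\<close> at that same point. Restriction to the row of s + 2 points that this quotient
  reads achieves this.\<close>

lemma norm_funpow_dq_x_compose:
  fixes f :: "'a::real_normed_vector \<Rightarrow> 'b::real_normed_vector"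
  assumes f: "C_infinity f" and h: "0 < h" and C: "1 \<le> C"
    and db: "deriv_bound f (Suc s) (hull_of D u) C" and u: "dq_bounded h s D C u"
    and xy: "(x, y) \<in> (dom_x h ^^ Suc s) D"
    and L: "C \<le> L" "norm ((dq_x h ^^ Suc s) u x y) \<le> L"
  shows "norm ((dq_x h ^^ Suc s) (\<lambda>x y. f (u x y)) x y) \<le> chain_const C s 1 * L"
proof -
  let ?R = "(\<lambda>i. (x + real i * h, y)) ` {..Suc s}"
  have R: "?R \<subseteq> D" using xy unfolding funpow_dom_x by blast
  \<comment> \<open>On the row only the left end admits s + 1 steps in x, and no point admits a step
    in y, so a bound of order s + 1 there amounts to the order s bounds and one single
    number.\<close>
  have corner: "p = (x, y)" if "p \<in> (dom_x h ^^ Suc s) ?R" for p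
  proof -
    obtain q z where p: "p = (q, z)" by force
    then have "(q + real 0 * h, z) \<in> ?R" "(q + real (Suc s) * h, z) \<in> ?R"
      using that unfolding p funpow_dom_x by blast+
    then have "\<exists>i j. q = x + real i * h \<and> z = y \<and> q + real (Suc s) * h = x + real j * h \<and> j \<le> Suc s"
      by (auto simp del: of_nat_Suc)
    then obtain i j where ij: "q = x + real i * h" "z = y" "q + real (Suc s) * h = x + real j * h" "j \<le> Suc s"
      by blast
    then have "(real i + real (Suc s)) * h = real j * h" by (simp add: algebra_simps)
    with h have "real (i + Suc s) = real j" by simp
    with ij(4) have "i = 0" by linarith
    with ij p show ?thesis by simp
  qed
  have empty: "dom_y h ?R = {}" using h by (auto simp: dom_y_def)
  have triv: "dq_bounded h n {} c w" for n c and w :: "real \<Rightarrow> real \<Rightarrow> 'a"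
    by (induction n arbitrary: w) (auto simp: dom_x_def dom_y_def)
  have "dq_bounded h (Suc s) ?R L u"
  proof (rule dq_bounded_SucI)
    show "norm ((dq_x h ^^ Suc s) u p q) \<le> L" if "(p, q) \<in> (dom_x h ^^ Suc s) ?R" for p q
      using corner[OF that] L(2) by (metis prod.inject)
  qed (use dq_bounded_mono[OF u R L(1)] empty triv in auto)
  then have "dq_bounded h s (dom_x h ?R) L (dq_x h u)" by simp
  with dq_bounded_compose_dq_x[OF f _ C deriv_bound_mono[OF db order_refl hull_mono[OF image_mono[OF R]]]
      dq_bounded_mono[OF u R order_refl order_refl]] h C L(1)
  have "dq_bounded h s (dom_x h ?R) (chain_const C s 1 * L) (dq_x h (\<lambda>x y. f (u x y)))"
    by simp
  moreover have "(x, y) \<in> (dom_x h ^^ Suc s) ?R" unfolding funpow_dom_x by auto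
  ultimately show ?thesis
    using dq_bounded_funpow_dq_x[OF _ order_refl, of h s "dom_x h ?R" _ "dq_x h (\<lambda>x y. f (u x y))" x y]
    unfolding funpow_Suc_right comp_def by blast
qed

text \<open>Adding \<open>B\<close> makes the recursion geometric with ratio 1 + h c, which is at
  most exp(h c).\<close>

lemma discrete_gronwall:
  fixes A :: "nat \<Rightarrow> real"
  assumes "\<And>j. j < n \<Longrightarrow> A (Suc j) \<le> A j + h * c * (B + A j)" and "0 \<le> h * c" "0 \<le> B" "0 \<le> A 0"
  shows "A n \<le> exp (real n * (h * c)) * (B + A 0)"
proof -
  have "A n + B \<le> (1 + h * c) ^ n * (B + A 0)"
    using assms(1)
  proof (induction n)
    case (Suc n)
    have "A (Suc n) + B \<le> (1 + h * c) * (A n + B)"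
      using Suc.prems[of n] by (simp add: algebra_simps)
    also have "\<dots> \<le> (1 + h * c) * ((1 + h * c) ^ n * (B + A 0))"
      using Suc assms(2) by (intro mult_left_mono) auto
    finally show ?case by simp
  qed simp
  also have "\<dots> \<le> exp (h * c) ^ n * (B + A 0)"
    using assms exp_ge_add_one_self[of "h * c"] by (intro mult_right_mono power_mono) auto
  finally show ?thesis using assms(3) by (simp add: exp_of_nat_mult)
qed

lemma funpow_dom_x_grid_square:
  assumes "0 < h"
  shows "(x, y) \<in> (dom_x h ^^ m) (grid_square h r) \<longleftrightarrow>
    x \<in> grid h r \<and> x + real m * h \<in> grid h r \<and> y \<in> grid h r"
proof -
  have "x + real i * h \<in> grid h r" if "x \<in> grid h r" "x + real m * h \<in> grid h r" "i \<le> m" for i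
  proof -
    have "real i * h \<le> real m * h" using that(3) assms by simp
    with that(2) have "x + real i * h \<le> r" by (auto dest: grid_bounds)
    with grid_add[OF assms that(1)] show ?thesis by blast
  qed
  then show ?thesis
    unfolding funpow_dom_x grid_square_def by force
qed

lemma zero_mem_grid: "0 \<le> r \<Longrightarrow> 0 \<in> grid h r"
  by (auto simp: grid_def intro: range_eqI[of _ _ 0])

lemma dom_y_grid_square: "(x, y) \<in> dom_y h (grid_square h r) \<longleftrightarrow>
    x \<in> grid h r \<and> y \<in> grid h r \<and> y + h \<in> grid h r"
  and dom_x_grid_square: "(x, y) \<in> dom_x h (grid_square h r) \<longleftrightarrow>
    x \<in> grid h r \<and> x + h \<in> grid h r \<and> y \<in> grid h r"
  by (auto simp: dom_y_def dom_x_def grid_square_def)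

lemma dq_y_step: "dq_y h P x y = w \<Longrightarrow> 0 < h \<Longrightarrow> P x (y + h) = P x y + h *\<^sub>R w"
  unfolding dq_y_def by (auto simp: scaleR_diff_right[symmetric])

text \<open>Gronwall in y along a fixed column \<open>x\<close>. Applying the pure x-quotient to the
  equation gives a recursion in y; \<open>B\<close> bounds both the part of \<open>u\<close> that
  does not come from \<open>a\<close> and the data on y = 0.\<close>

lemma pure_x_bound:
  fixes f :: "'a::real_normed_vector \<Rightarrow> 'b::real_normed_vector"
  assumes f: "C_infinity f" and h: "0 < h" and C: "1 \<le> C" and B: "0 \<le> B"
    and db: "deriv_bound f (Suc s) (hull_of (grid_square h r) u) C"
    and u: "dq_bounded h s (grid_square h r) C u"
    and eq: "\<And>x y. (x, y) \<in> dom_y h (grid_square h r) \<Longrightarrow> dq_y h a x y = f (u x y)"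
    and top: "\<And>x y. (x, y) \<in> (dom_x h ^^ Suc s) (grid_square h r) \<Longrightarrow>
      norm ((dq_x h ^^ Suc s) u x y) \<le> B + norm ((dq_x h ^^ Suc s) a x y)"
    and init: "\<And>x. (x, 0) \<in> (dom_x h ^^ Suc s) (grid_square h r) \<Longrightarrow>
      norm ((dq_x h ^^ Suc s) a x 0) \<le> B"
    and xy: "(x, y) \<in> (dom_x h ^^ Suc s) (grid_square h r)"
  shows "norm ((dq_x h ^^ Suc s) a x y) \<le> exp (r * chain_const C s 1) * (C + 2 * B)"
proof -
  define A where "A j = norm ((dq_x h ^^ Suc s) a x (real j * h))" for j :: nat
  let ?c = "chain_const C s 1"
  have c: "0 \<le> ?c" using chain_const_nonneg C by simp
  from xy have x: "x \<in> grid h r" "x + real (Suc s) * h \<in> grid h r" and "y \<in> grid h r"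
    by (simp_all only: funpow_dom_x_grid_square[OF h])
  then obtain n where n: "y = real n * h" "real n * h \<le> r" using grid_iff_nat[OF h] by blast
  have dom: "(x, real j * h) \<in> (dom_x h ^^ Suc s) (grid_square h r)" if "j \<le> n" for j
  proof -
    have "real j * h \<le> real n * h" using that h by simp
    with n have "real j * h \<in> grid h r" by (auto simp: grid_iff_nat[OF h])
    with x show ?thesis by (simp only: funpow_dom_x_grid_square[OF h] simp_thms)
  qed
  have "A n \<le> exp (real n * (h * ?c)) * ((C + B) + A 0)"
  proof (rule discrete_gronwall)
    fix j assume j: "j < n"
    let ?y = "real j * h"
    have y': "real (Suc j) * h = ?y + h" by (simp add: algebra_simps)
    have "(dq_x h ^^ Suc s) (dq_y h a) x ?y = (dq_x h ^^ Suc s) (\<lambda>x y. f (u x y)) x ?y"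
    proof (rule funpow_dq_x_cong)
      fix i assume "i \<le> Suc s"
      then have "(x + real i * h, ?y) \<in> grid_square h r" "(x + real i * h, ?y + h) \<in> grid_square h r"
        using dom[of j] dom[of "Suc j"] j unfolding funpow_dom_x y' by auto
      then show "dq_y h a (x + real i * h) ?y = f (u (x + real i * h) ?y)"
        by (intro eq) (simp add: dom_y_def)
    qed
    then have "dq_y h ((dq_x h ^^ Suc s) a) x ?y = (dq_x h ^^ Suc s) (\<lambda>x y. f (u x y)) x ?y"
      by (simp only: dq_y_funpow_dq_x)
    from dq_y_step[OF this] h have "(dq_x h ^^ Suc s) a x (real (Suc j) * h) =
        (dq_x h ^^ Suc s) a x ?y + h *\<^sub>R (dq_x h ^^ Suc s) (\<lambda>x y. f (u x y)) x ?y"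
      unfolding y' by blast
    then have "A (Suc j) \<le> A j + h * norm ((dq_x h ^^ Suc s) (\<lambda>x y. f (u x y)) x ?y)"
      unfolding A_def using h norm_triangle_ineq by (metis abs_of_pos norm_scaleR)
    \<comment> \<open>Here L = C + B + A j: it is at least \<open>C\<close>, as the composition
      estimate demands, and it dominates the top quotient of \<open>u\<close>.\<close>
    also have "\<dots> \<le> A j + h * (?c * (C + B + A j))"
      using norm_funpow_dq_x_compose[OF f h C db u dom, of j "C + B + A j"] top[OF dom, of j] j h C B
      by (simp add: A_def)
    finally show "A (Suc j) \<le> A j + h * ?c * (C + B + A j)" by (simp add: mult.assoc)
  qed (use h c C B in \<open>auto simp: A_def\<close>)
  also have "\<dots> \<le> exp (r * ?c) * (C + 2 * B)"
  proof (rule mult_mono)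
    have "real n * h * ?c \<le> r * ?c" using n c by (intro mult_right_mono) auto
    then show "exp (real n * (h * ?c)) \<le> exp (r * ?c)" by (simp add: mult.assoc)
    show "C + B + A 0 \<le> C + 2 * B" using init dom[of 0] by (simp add: A_def)
  qed (use C B in \<open>auto simp: A_def\<close>)
  finally show ?thesis by (simp add: A_def n(1))
qed

text \<open>A sum in place of a maximum of three bounds: the lower orders, the quotients of
  \<open>dq_y h a\<close> = f(u), and the Gronwall bound with B =
  \<open>chain_const C s 0 + M\<close>.\<close>

definition step_const :: "real \<Rightarrow> real \<Rightarrow> real \<Rightarrow> nat \<Rightarrow> real" where
  "step_const r M C s = C + chain_const C s 0 +
     exp (r * chain_const C s 1) * (C + 2 * (chain_const C s 0 + M))"

text \<open>The coupling is harmless: a pure x-quotient of \<open>b\<close> of order s + 1 is an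
  order s quotient of g(u), hence already bounded, so only \<open>a\<close> remains on the right of
  the recursion. With \<open>u\<close> kept abstract the lemma also serves with the variables
  exchanged.\<close>

lemma dq_bounded_order_step:
  fixes f :: "'a::real_normed_vector \<Rightarrow> 'b::real_normed_vector"
    and g :: "'a \<Rightarrow> 'c::real_normed_vector"
  assumes f: "C_infinity f" and g: "C_infinity g" and h: "0 < h" and C: "1 \<le> C" and M: "0 \<le> M"
    and dbf: "deriv_bound f (Suc s) (hull_of (grid_square h r) u) C"
    and dbg: "deriv_bound g (Suc s) (hull_of (grid_square h r) u) C"
    and u: "dq_bounded h s (grid_square h r) C u" and a: "dq_bounded h s (grid_square h r) C a"
    and eqa: "\<And>x y. (x, y) \<in> dom_y h (grid_square h r) \<Longrightarrow> dq_y h a x y = f (u x y)"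
    and eqb: "\<And>x y. (x, y) \<in> dom_x h (grid_square h r) \<Longrightarrow> dq_x h b x y = g (u x y)"
    and top: "\<And>x y. norm ((dq_x h ^^ Suc s) u x y) \<le>
      norm ((dq_x h ^^ Suc s) b x y) + norm ((dq_x h ^^ Suc s) a x y)"
    and init: "\<And>x. x \<in> grid h r \<Longrightarrow> x + real (Suc s) * h \<in> grid h r \<Longrightarrow>
      norm ((dq_x h ^^ Suc s) a x 0) \<le> M"
  shows "dq_bounded h (Suc s) (grid_square h r) (step_const r M C s) a"
proof -
  let ?D = "grid_square h r" and ?c = "chain_const C s 0"
  have c: "0 \<le> ?c" using chain_const_nonneg C by simp
  have h0: "h \<noteq> 0" and C0: "0 \<le> C" using h C by auto
  have const: "C \<le> step_const r M C s" "?c \<le> step_const r M C s"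
    "exp (r * chain_const C s 1) * (C + 2 * (?c + M)) \<le> step_const r M C s"
    using c C M by (auto simp: step_const_def)
  have fu: "dq_bounded h s ?D ?c (\<lambda>x y. f (u x y))"
    by (rule dq_bounded_compose[OF f h0 C0 deriv_bound_mono[OF dbf] u]) auto
  have gu: "dq_bounded h s ?D ?c (\<lambda>x y. g (u x y))"
    by (rule dq_bounded_compose[OF g h0 C0 deriv_bound_mono[OF dbg] u]) auto
  have "dq_bounded h s (dom_y h ?D) ?c (dq_y h a)"
    using dq_bounded_mono[OF fu dom_subset(2) order_refl order_refl] eqa
    by (subst dq_bounded_cong[where v = "\<lambda>x y. f (u x y)"]) auto
  then have ya: "dq_bounded h s (dom_y h ?D) (step_const r M C s) (dq_y h a)"
    by (rule dq_bounded_mono) (use const in auto)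
  have "dq_bounded h s (dom_x h ?D) ?c (dq_x h b)"
    using dq_bounded_mono[OF gu dom_subset(1) order_refl order_refl] eqb
    by (subst dq_bounded_cong[where v = "\<lambda>x y. g (u x y)"]) auto
  from dq_bounded_funpow_dq_x[OF this order_refl]
  have b: "norm ((dq_x h ^^ Suc s) b x y) \<le> ?c" if "(x, y) \<in> (dom_x h ^^ Suc s) ?D" for x y
    using that unfolding funpow_Suc_right comp_def by blast
  have "norm ((dq_x h ^^ Suc s) a x y) \<le> exp (r * chain_const C s 1) * (C + 2 * (?c + M))"
    if "(x, y) \<in> (dom_x h ^^ Suc s) ?D" for x y
  proof (rule pure_x_bound[OF f h C _ dbf u eqa _ _ that])
    show "norm ((dq_x h ^^ Suc s) u x y) \<le> ?c + M + norm ((dq_x h ^^ Suc s) a x y)"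
      if "(x, y) \<in> (dom_x h ^^ Suc s) ?D" for x y
      using top[of x y] b[OF that] M by linarith
    show "norm ((dq_x h ^^ Suc s) a x 0) \<le> ?c + M" if "(x, 0) \<in> (dom_x h ^^ Suc s) ?D" for x
      using init[of x] that c unfolding funpow_dom_x_grid_square[OF h] by linarith
  qed (use c M in auto)
  then show ?thesis
    using dq_bounded_mono[OF a order_refl const(1) order_refl] ya const(3)
    by (intro dq_bounded_SucI) (auto intro: order_trans simp del: funpow.simps)
qed

lemma norm_snd_Pair_le: "norm (x, y) \<le> norm y + norm x"
  using norm_Pair_le[of x y] by simp

lemma grid_square_swap: "prod.swap ` grid_square h r = grid_square h r"
  by (auto simp: grid_square_def mem_swap_image)

lemma dq_bounded_system_step:
  fixes f g :: "'a::real_normed_vector \<times> 'a \<Rightarrow> 'a"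
  assumes f: "C_infinity f" and g: "C_infinity g" and h: "0 < h" and C: "1 \<le> C" and M: "0 \<le> M"
    and dbf: "deriv_bound f (Suc s) (hull_of (grid_square h r) (\<lambda>x y. (a x y, b x y))) C"
    and dbg: "deriv_bound g (Suc s) (hull_of (grid_square h r) (\<lambda>x y. (a x y, b x y))) C"
    and u: "dq_bounded h s (grid_square h r) C (\<lambda>x y. (a x y, b x y))"
    and a: "dq_bounded h s (grid_square h r) C a" and b: "dq_bounded h s (grid_square h r) C b"
    and sol: "discrete_goursat_solution h r f g a0 b0 a b"
    and a0: "\<And>x. x \<in> grid h r \<Longrightarrow> x + real (Suc s) * h \<in> grid h r \<Longrightarrow> norm ((dq h ^^ Suc s) a0 x) \<le> M"
    and b0: "\<And>x. x \<in> grid h r \<Longrightarrow> x + real (Suc s) * h \<in> grid h r \<Longrightarrow> norm ((dq h ^^ Suc s) b0 x) \<le> M"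
  shows "dq_bounded h (Suc s) (grid_square h r) (step_const r M C s) a"
    and "dq_bounded h (Suc s) (grid_square h r) (step_const r M C s) b"
proof -
  let ?D = "grid_square h r" and ?u = "\<lambda>x y. (a x y, b x y)"
  have eqa: "dq_y h a x y = f (a x y, b x y)" if "(x, y) \<in> dom_y h ?D" for x y
    using sol that by (auto simp: discrete_goursat_solution_def dom_y_grid_square)
  have eqb: "dq_x h b x y = g (a x y, b x y)" if "(x, y) \<in> dom_x h ?D" for x y
    using sol that by (auto simp: discrete_goursat_solution_def dom_x_grid_square)
  have init: "norm ((dq_x h ^^ Suc s) v x 0) \<le> M"
    if "x \<in> grid h r" "x + real (Suc s) * h \<in> grid h r" "\<And>x. x \<in> grid h r \<Longrightarrow> v x 0 = v0 x"
      "norm ((dq h ^^ Suc s) v0 x) \<le> M" for x and v v0 :: "_ \<Rightarrow> _"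
  proof -
    have r: "0 \<le> r" using grid_bounds[OF that(1)] by simp
    have "(x, 0) \<in> (dom_x h ^^ Suc s) ?D"
      using that r h by (simp only: funpow_dom_x_grid_square[OF h]) (auto simp: zero_mem_grid)
    then have "(dq_x h ^^ Suc s) v x 0 = (dq h ^^ Suc s) v0 x"
      using that(3) unfolding funpow_dom_x by (intro funpow_dq_x_eq_dq) (auto simp: grid_square_def)
    with that(4) show ?thesis by simp
  qed
  show "dq_bounded h (Suc s) ?D (step_const r M C s) a"
  proof (rule dq_bounded_order_step[OF f g h C M dbf dbg u a eqa eqb])
    show "norm ((dq_x h ^^ Suc s) ?u x y) \<le> norm ((dq_x h ^^ Suc s) b x y) + norm ((dq_x h ^^ Suc s) a x y)" for x y
      unfolding funpow_dq_x_Pair by (rule norm_snd_Pair_le)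
    show "norm ((dq_x h ^^ Suc s) a x 0) \<le> M" if "x \<in> grid h r" "x + real (Suc s) * h \<in> grid h r" for x
      using sol a0[OF that] by (intro init[OF that, of _ a0]) (auto simp: discrete_goursat_solution_def)
  qed
  \<comment> \<open>Exchanging x and y exchanges the roles of (a, f) and (b, g). The pair keeps its
    order, so \<open>f\<close> and \<open>g\<close> are applied as before.\<close>
  let ?u' = "\<lambda>x y. ?u y x"
  have hull: "hull_of ?D ?u' = hull_of ?D ?u"
    using grid_square_swap[of h r] by (force intro!: arg_cong[where f = "\<lambda>S. convex hull S"] simp: image_iff)
  have "dq_bounded h (Suc s) ?D (step_const r M C s) (\<lambda>x y. b y x)"
  proof (rule dq_bounded_order_step[where u = ?u' and b = "\<lambda>x y. a y x", OF g f h C M])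
    show "deriv_bound g (Suc s) (hull_of ?D ?u') C" "deriv_bound f (Suc s) (hull_of ?D ?u') C"
      unfolding hull by fact+
    show "dq_bounded h s ?D C ?u'" "dq_bounded h s ?D C (\<lambda>x y. b y x)"
      using dq_bounded_flipI[OF u] dq_bounded_flipI[OF b] by (simp_all add: grid_square_swap)
    show "dq_y h (\<lambda>x y. b y x) x y = g (a y x, b y x)" if "(x, y) \<in> dom_y h ?D" for x y
      using eqb[of y x] that by (simp add: dq_y_flip[of h b] dom_x_grid_square dom_y_grid_square)
    show "dq_x h (\<lambda>x y. a y x) x y = f (a y x, b y x)" if "(x, y) \<in> dom_x h ?D" for x y
      using eqa[of y x] that by (simp add: dq_x_flip[of h a] dom_x_grid_square dom_y_grid_square)
    show "norm ((dq_x h ^^ Suc s) ?u' x y) \<le>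
        norm ((dq_x h ^^ Suc s) (\<lambda>x y. a y x) x y) + norm ((dq_x h ^^ Suc s) (\<lambda>x y. b y x) x y)" for x y
      unfolding funpow_dq_x_Pair by (rule norm_Pair_le)
    show "norm ((dq_x h ^^ Suc s) (\<lambda>x y. b y x) x 0) \<le> M" if "x \<in> grid h r" "x + real (Suc s) * h \<in> grid h r" for x
      using sol b0[OF that] by (intro init[OF that, of _ b0]) (auto simp: discrete_goursat_solution_def)
  qed
  from dq_bounded_flipI[OF this] show "dq_bounded h (Suc s) ?D (step_const r M C s) b"
    by (simp only: grid_square_swap)
qed

section \<open>Limits of grid functions with bounded difference quotients\<close>

text \<open>The difference of two slopes, multiplied by both lengths, is the double sum of w i - w j
  over the increments \<open>w\<close>; second differences telescope to bound each term by (d - c)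
  B. The division-free form admits degenerate intervals.\<close>

lemma divided_difference_bound:
  fixes v :: "nat \<Rightarrow> 'a::real_normed_vector"
  assumes "\<And>i. i + 2 \<le> n \<Longrightarrow> norm ((v (i + 2) - v (i + 1)) - (v (i + 1) - v i)) \<le> B"
    and "p \<le> q" "s \<le> t" "c \<le> p" "c \<le> s" "q \<le> d" "t \<le> d" "d \<le> n" and "0 \<le> B"
  shows "norm (real (t - s) *\<^sub>R (v q - v p) - real (q - p) *\<^sub>R (v t - v s))
    \<le> real (t - s) * real (q - p) * real (d - c) * B"
proof -
  define w where "w i = v (Suc i) - v i" for i
  have up: "norm (w (i + l) - w i) \<le> real l * B" if "i + l < n" for i l
    using that
  proof (induction l)
    case (Suc l)
    have "norm (w (i + Suc l) - w (i + l)) \<le> B"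
      using assms(1)[of "i + l"] Suc.prems by (simp add: w_def)
    with Suc norm_triangle_ineq[of "w (i + Suc l) - w (i + l)" "w (i + l) - w i"]
    show ?case by (simp add: algebra_simps)
  qed simp
  have near: "norm (w i - w j) \<le> real (d - c) * B" if "i \<in> {p..<q}" "j \<in> {s..<t}" for i j
  proof (cases "i \<le> j")
    case True
    have "norm (w i - w j) \<le> real (j - i) * B"
      using up[of i "j - i"] True that assms by (simp add: norm_minus_commute)
    also have "\<dots> \<le> real (d - c) * B" using that assms by (intro mult_right_mono) auto
    finally show ?thesis .
  next
    case False
    have "norm (w i - w j) \<le> real (i - j) * B"
      using up[of j "i - j"] False that assms by simp
    also have "\<dots> \<le> real (d - c) * B" using that assms by (intro mult_right_mono) auto
    finally show ?thesis .
  qed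
  have tel: "v q - v p = (\<Sum>i\<in>{p..<q}. w i)" "v t - v s = (\<Sum>i\<in>{s..<t}. w i)"
    using assms(2,3) by (simp_all add: w_def sum_Suc_diff')
  have "real (t - s) *\<^sub>R (v q - v p) - real (q - p) *\<^sub>R (v t - v s) =
      (\<Sum>i\<in>{p..<q}. \<Sum>j\<in>{s..<t}. w i - w j)"
    unfolding tel sum_subtractf by (simp add: scaleR_sum_right sum_constant_scaleR)
  also have "norm \<dots> \<le> (\<Sum>i\<in>{p..<q}. \<Sum>j\<in>{s..<t}. real (d - c) * B)"
    using near by (intro order_trans[OF norm_sum] sum_mono) auto
  finally show ?thesis by (simp add: algebra_simps)
qed

text \<open>The index \<open>l\<close> counts the quotients already taken, each of which costs one
  row of the grid, while the limit \<open>u\<close> lives on the full square.\<close>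

definition grid_limit ::
  "real \<Rightarrow> real \<Rightarrow> nat \<Rightarrow> (real \<Rightarrow> real \<Rightarrow> real \<Rightarrow> 'a::real_normed_vector) \<Rightarrow> (real \<Rightarrow> real \<Rightarrow> 'a) \<Rightarrow> bool"
  where "grid_limit e0 r l U u \<longleftrightarrow>
    (\<forall>e>0. \<forall>\<^sub>F h in at 0 within mesh e0. \<forall>x y. (x, y) \<in> grid_square h (r - real l * h) \<longrightarrow>
       norm (U h x y - u x y) < e)"

text \<open>Lowering the index by \<open>l\<close> keeps the rounded points of \<open>[0, r]\<close> in the grid of \<open>[0, r - l h]\<close>;
  near \<open>0\<close> they are moved to \<open>0\<close> by the truncation.\<close>

definition round_down :: "nat \<Rightarrow> real \<Rightarrow> real \<Rightarrow> nat" where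
  "round_down l h x = nat (\<lfloor>x / h\<rfloor> - int l)"

lemma round_down_mono: "0 < h \<Longrightarrow> x \<le> y \<Longrightarrow> round_down l h x \<le> round_down l h y"
  unfolding round_down_def by (intro nat_mono diff_right_mono floor_mono divide_right_mono) auto

lemma round_down_bounds:
  assumes "0 < h" "0 \<le> x" "x \<le> r" "real l * h \<le> r"
  shows "real (round_down l h x) * h \<le> r - real l * h"
    and "real (round_down l h x) * h \<le> x" and "x - (real l + 1) * h \<le> real (round_down l h x) * h"
proof -
  have f: "of_int \<lfloor>x / h\<rfloor> * h \<le> x" "x < (of_int \<lfloor>x / h\<rfloor> + 1) * h"
    using assms(1) floor_correct[of "x / h"]
    by (simp_all add: pos_le_divide_eq[symmetric] pos_divide_less_eq[symmetric])
  have n: "0 \<le> \<lfloor>x / h\<rfloor>" using assms by simp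
  show "real (round_down l h x) * h \<le> r - real l * h" "real (round_down l h x) * h \<le> x"
    "x - (real l + 1) * h \<le> real (round_down l h x) * h"
  proof -
    consider "int l \<le> \<lfloor>x / h\<rfloor>" | "\<lfloor>x / h\<rfloor> < int l" by linarith
    then have "real (round_down l h x) * h \<le> r - real l * h \<and> real (round_down l h x) * h \<le> x
      \<and> x - (real l + 1) * h \<le> real (round_down l h x) * h"
    proof cases
      case 1
      then have "real (round_down l h x) * h = of_int \<lfloor>x / h\<rfloor> * h - real l * h"
        by (simp add: round_down_def left_diff_distrib)
      moreover have "0 \<le> real l * h" using assms(1) by simp
      moreover have "(real l + 1) * h = real l * h + h"
        "(of_int \<lfloor>x / h\<rfloor> + 1) * h = of_int \<lfloor>x / h\<rfloor> * h + h"
        by (simp_all add: distrib_right)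
      ultimately show ?thesis using f assms(3) by (intro conjI) linarith+
    next
      case 2
      then have "real (round_down l h x) * h = 0" by (simp add: round_down_def)
      moreover have "(of_int \<lfloor>x / h\<rfloor> + 1) * h \<le> (real l + 1) * h"
        using 2 assms(1) by (intro mult_right_mono) auto
      ultimately show ?thesis using f assms by (intro conjI) linarith+
    qed
    then show "real (round_down l h x) * h \<le> r - real l * h" "real (round_down l h x) * h \<le> x"
      "x - (real l + 1) * h \<le> real (round_down l h x) * h" by simp_all
  qed
qed

lemma eventually_mesh: "\<forall>\<^sub>F h in at 0 within mesh e0. h \<in> mesh e0"
  by (auto simp: eventually_at_filter)

lemma eventually_mesh_less: "0 < d \<Longrightarrow> \<forall>\<^sub>F h in at 0 within mesh e0. h < d"
  unfolding eventually_at by (intro exI[of _ d]) (auto simp: dist_real_def)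

lemma eventually_mesh_mult_le:
  assumes "0 < r"
  shows "\<forall>\<^sub>F h in at 0 within mesh e0. c * h \<le> r"
proof -
  have "0 < r / (\<bar>c\<bar> + 1)" using assms by (intro divide_pos_pos) auto
  from eventually_mesh_less[OF this] eventually_mesh show ?thesis
  proof eventually_elim
    case (elim h)
    have "c * h \<le> (\<bar>c\<bar> + 1) * h" using mesh_pos[OF elim(2)] by (intro mult_right_mono) auto
    also have "\<dots> \<le> r" using elim(1) by (simp add: field_simps)
    finally show ?case .
  qed
qed

lemma round_down_tendsto:
  assumes "0 < r" "0 \<le> x" "x \<le> r"
  shows "((\<lambda>h. real (round_down l h x) * h) \<longlongrightarrow> x) (at 0 within mesh e0)"
proof (rule tendsto_sandwich)
  have ev: "\<forall>\<^sub>F h in at 0 within mesh e0. h \<in> mesh e0 \<and> real l * h \<le> r"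
    using eventually_mesh eventually_mesh_mult_le[OF assms(1)] by eventually_elim simp
  show "\<forall>\<^sub>F h in at 0 within mesh e0. x - (real l + 1) * h \<le> real (round_down l h x) * h"
    using ev
  proof eventually_elim
    case (elim h)
    with mesh_pos[of h e0] round_down_bounds(3)[of h x r l] assms show ?case by blast
  qed
  show "\<forall>\<^sub>F h in at 0 within mesh e0. real (round_down l h x) * h \<le> x"
    using ev
  proof eventually_elim
    case (elim h)
    with mesh_pos[of h e0] round_down_bounds(2)[of h x r l] assms show ?case by blast
  qed
  show "((\<lambda>h. x - (real l + 1) * h) \<longlongrightarrow> x) (at 0 within mesh e0)"
    by (auto intro!: tendsto_eq_intros)
qed simp

text \<open>Recovers \<open>u\<close> at every point of the closed square, including the edges that
  the shrunken grids do not reach; continuity of \<open>u\<close> absorbs the displacement of the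
  rounded points.\<close>

lemma grid_limit_round_down:
  assumes lim: "grid_limit e0 r l U u" and u: "continuous_on (square r) (case_prod u)"
    and r: "0 < r" and x: "0 \<le> x" "x \<le> r" and y: "0 \<le> y" "y \<le> r"
  shows "((\<lambda>h. U h (real (round_down l h x) * h) (real (round_down l h y) * h)) \<longlongrightarrow> u x y)
    (at 0 within mesh e0)"
proof -
  let ?R = "\<lambda>h x. real (round_down l h x) * h"
  have ev: "\<forall>\<^sub>F h in at 0 within mesh e0. h \<in> mesh e0 \<and> real l * h \<le> r"
    using eventually_mesh eventually_mesh_mult_le[OF r] by eventually_elim simp
  have mem: "(?R h x, ?R h y) \<in> grid_square h (r - real l * h)" "(?R h x, ?R h y) \<in> square r"
    if "h \<in> mesh e0 \<and> real l * h \<le> r" for h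
  proof -
    have h: "0 < h" "real l * h \<le> r" using that mesh_pos[of h e0] by auto
    then have "0 \<le> real l * h" by simp
    show "(?R h x, ?R h y) \<in> grid_square h (r - real l * h)"
      using h round_down_bounds[OF h(1) x h(2)] round_down_bounds[OF h(1) y h(2)]
      by (auto simp: grid_square_def grid_iff_nat)
    then show "(?R h x, ?R h y) \<in> square r"
      using \<open>0 \<le> real l * h\<close> by (auto simp: grid_square_def square_def dest!: grid_bounds)
  qed
  have "((\<lambda>h. case_prod u (?R h x, ?R h y)) \<longlongrightarrow> case_prod u (x, y)) (at 0 within mesh e0)"
  proof (rule continuous_on_tendsto_compose[OF u])
    show "((\<lambda>h. (?R h x, ?R h y)) \<longlongrightarrow> (x, y)) (at 0 within mesh e0)"
      by (intro tendsto_Pair round_down_tendsto[OF r] x y)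
    show "(x, y) \<in> square r" using x y by (simp add: square_def)
    show "\<forall>\<^sub>F h in at 0 within mesh e0. (?R h x, ?R h y) \<in> square r"
      using ev by eventually_elim (rule mem)
  qed
  then have 1: "((\<lambda>h. u (?R h x) (?R h y)) \<longlongrightarrow> u x y) (at 0 within mesh e0)" by simp
  have 2: "((\<lambda>h. U h (?R h x) (?R h y) - u (?R h x) (?R h y)) \<longlongrightarrow> 0) (at 0 within mesh e0)"
  proof (rule tendstoI)
    fix e :: real assume "0 < e"
    with lim have "\<forall>\<^sub>F h in at 0 within mesh e0. \<forall>x y. (x, y) \<in> grid_square h (r - real l * h) \<longrightarrow>
       norm (U h x y - u x y) < e"
      unfolding grid_limit_def by blast
    with ev show "\<forall>\<^sub>F h in at 0 within mesh e0. dist (U h (?R h x) (?R h y) - u (?R h x) (?R h y)) 0 < e"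
      by eventually_elim (use mem(1) in auto)
  qed
  from tendsto_add[OF 2 1] show ?thesis by simp
qed

lemma second_dq_grid:
  assumes h: "0 < h" and U: "dq_bounded h 2 (grid_square h R) M V"
    and i: "real (i + 2) * h \<le> R" and y: "y \<in> grid h R"
  shows "norm ((V (real (i + 2) * h) y - V (real (i + 1) * h) y) - (V (real (i + 1) * h) y - V (real i * h) y))
    \<le> M * h\<^sup>2"
proof -
  have "(real i * h, y) \<in> (dom_x h ^^ 2) (grid_square h R)"
  proof -
    have "real i * h \<le> real (i + 2) * h" using h by (intro mult_right_mono) auto
    then have "real i * h \<in> grid h R" "real (i + 2) * h \<in> grid h R"
      using i grid_iff_nat[OF h] by fastforce+
    moreover have "real (i + 2) * h = real i * h + real 2 * h" by (simp add: algebra_simps)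
    ultimately show ?thesis using y by (simp only: funpow_dom_x_grid_square[OF h] simp_thms)
  qed
  from dq_bounded_funpow_dq_x[OF U order_refl this]
  have "norm ((dq_x h ^^ 2) V (real i * h) y) \<le> M" .
  moreover have "(V (real (i + 2) * h) y - V (real (i + 1) * h) y) - (V (real (i + 1) * h) y - V (real i * h) y)
      = h\<^sup>2 *\<^sub>R (dq_x h ^^ 2) V (real i * h) y"
    using h by (simp add: numeral_2_eq_2 dq_x_def algebra_simps power2_eq_square)
  ultimately show ?thesis using h by (simp add: mult.commute)
qed

text \<open>In terms of lengths all powers of the mesh size cancel, so the bound survives the
  limit.\<close>

lemma discrete_divided_difference_bound:
  assumes h: "0 < h" and U: "dq_bounded h 2 (grid_square h R) M V" and M: "0 \<le> M"
    and "p \<le> q" "s \<le> t" "c \<le> p" "c \<le> s" "q \<le> d" "t \<le> d" and d: "real d * h \<le> R"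
    and y: "y \<in> grid h R"
  shows "norm ((real t * h - real s * h) *\<^sub>R (V (real q * h) y - V (real p * h) y)
      - (real q * h - real p * h) *\<^sub>R (V (real t * h) y - V (real s * h) y))
    \<le> (real t * h - real s * h) * (real q * h - real p * h) * (real d * h - real c * h) * M"
proof -
  have "norm (real (t - s) *\<^sub>R (V (real q * h) y - V (real p * h) y)
      - real (q - p) *\<^sub>R (V (real t * h) y - V (real s * h) y))
    \<le> real (t - s) * real (q - p) * real (d - c) * (M * h\<^sup>2)" (is "norm ?A \<le> ?B")
  proof (rule divided_difference_bound[where v = "\<lambda>i. V (real i * h) y" and n = d])
    fix i assume "i + 2 \<le> d"
    then have "real (i + 2) * h \<le> real d * h" using h by (intro mult_right_mono) linarith+
    with d have "real (i + 2) * h \<le> R" by simp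
    from second_dq_grid[OF h U this y]
    show "norm ((V (real (i + 2) * h) y - V (real (i + 1) * h) y) - (V (real (i + 1) * h) y - V (real i * h) y))
      \<le> M * h\<^sup>2" .
  qed (use assms in auto)
  then have "norm (h *\<^sub>R ?A) \<le> h * ?B" using h by simp
  moreover have "h *\<^sub>R ?A = (real t * h - real s * h) *\<^sub>R (V (real q * h) y - V (real p * h) y)
      - (real q * h - real p * h) *\<^sub>R (V (real t * h) y - V (real s * h) y)"
    using assms by (simp add: of_nat_diff scaleR_diff_right left_diff_distrib right_diff_distrib mult.commute)
  moreover have "h * ?B = (real t * h - real s * h) * (real q * h - real p * h) * (real d * h - real c * h) * M"
    using assms by (simp add: of_nat_diff power2_eq_square left_diff_distrib[symmetric])
  ultimately show ?thesis by simp
qed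

text \<open>All points are rounded to the grid; rounding is monotone, so the order relations persist
  and the discrete estimate holds on each fine mesh before the limit is taken.\<close>

lemma limit_divided_difference_bound:
  assumes e0: "0 < e0" and lim: "grid_limit e0 r l U u" and u: "continuous_on (square r) (case_prod u)"
    and r: "0 < r" and U: "\<forall>\<^sub>F h in at 0 within mesh e0. dq_bounded h 2 (grid_square h (r - real l * h)) M (U h)"
    and M: "0 \<le> M" and "p \<le> q" "s \<le> t" "c \<le> p" "c \<le> s" "q \<le> d" "t \<le> d" "0 \<le> c" "d \<le> r"
    and y: "0 \<le> y" "y \<le> r"
  shows "norm ((t - s) *\<^sub>R (u q y - u p y) - (q - p) *\<^sub>R (u t y - u s y)) \<le> (t - s) * (q - p) * (d - c) * M"
proof -
  let ?F = "at 0 within mesh e0"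
  let ?R = "\<lambda>h x. real (round_down l h x) * h"
  have b: "0 \<le> p" "p \<le> r" "0 \<le> q" "q \<le> r" "0 \<le> s" "s \<le> r" "0 \<le> t" "t \<le> r" "0 \<le> c" "c \<le> r" "0 \<le> d" "d \<le> r"
    using assms by linarith+
  note lims = grid_limit_round_down[OF lim u r _ _ y]
  note rlims = round_down_tendsto[OF r, of _ l e0]
  have ev: "\<forall>\<^sub>F h in ?F. norm ((?R h t - ?R h s) *\<^sub>R (U h (?R h q) (?R h y) - U h (?R h p) (?R h y))
      - (?R h q - ?R h p) *\<^sub>R (U h (?R h t) (?R h y) - U h (?R h s) (?R h y)))
    \<le> (?R h t - ?R h s) * (?R h q - ?R h p) * (?R h d - ?R h c) * M"
    using eventually_mesh eventually_mesh_mult_le[OF r, of "real l"] U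
  proof eventually_elim
    case (elim h)
    have h: "0 < h" using elim(1) by (rule mesh_pos)
    have "?R h d \<le> r - real l * h" by (rule round_down_bounds) (use h b elim in auto)
    moreover have "?R h y \<in> grid h (r - real l * h)"
      using round_down_bounds(1)[OF h y elim(2)] grid_iff_nat[OF h] by blast
    ultimately show ?case
      by (intro discrete_divided_difference_bound[OF h elim(3) M])
        (use assms h in \<open>auto intro!: round_down_mono\<close>)
  qed
  show ?thesis
    by (rule tendsto_le[OF mesh_at_0_nontrivial[OF e0] _ _ ev])
      (intro tendsto_norm tendsto_diff tendsto_scaleR tendsto_mult tendsto_const lims rlims; fact b)+
qed

text \<open>A derivative-free substitute for a bound \<open>M\<close> on the second derivative:
  slopes over two intervals inside [c, d] differ by at most M (d - c).\<close>

definition divided_difference_bounded :: "real \<Rightarrow> real \<Rightarrow> (real \<Rightarrow> 'a::real_normed_vector) \<Rightarrow> bool" where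
  "divided_difference_bounded r M w \<longleftrightarrow>
    (\<forall>p q s t c d. p \<le> q \<longrightarrow> s \<le> t \<longrightarrow> c \<le> p \<longrightarrow> c \<le> s \<longrightarrow> q \<le> d \<longrightarrow> t \<le> d \<longrightarrow> 0 \<le> c \<longrightarrow> d \<le> r \<longrightarrow>
      norm ((t - s) *\<^sub>R (w q - w p) - (q - p) *\<^sub>R (w t - w s)) \<le> (t - s) * (q - p) * (d - c) * M)"

lemma divided_difference_bounded_base_point:
  assumes w: "divided_difference_bounded r M w" and M: "0 \<le> M"
    and "x \<in> {0..r}" "z \<in> {0..r}" "z' \<in> {0..r}"
  shows "norm ((z' - x) *\<^sub>R (w z - w x) - (z - x) *\<^sub>R (w z' - w x))
    \<le> \<bar>z' - x\<bar> * \<bar>z - x\<bar> * (\<bar>z - x\<bar> + \<bar>z' - x\<bar>) * M"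
proof -
  define c where "c = min x (min z z')"
  define d where "d = max x (max z z')"
  \<comment> \<open>The signs record on which side of \<open>x\<close> the points lie; reversing an
    interval flips the sign of the expression, which the norm ignores.\<close>
  define \<sigma> where "\<sigma> = (if x \<le> z then 1 else -1 :: real)"
  define \<tau> where "\<tau> = (if x \<le> z' then 1 else -1 :: real)"
  have "norm ((max x z' - min x z') *\<^sub>R (w (max x z) - w (min x z)) -
      (max x z - min x z) *\<^sub>R (w (max x z') - w (min x z')))
    \<le> (max x z' - min x z') * (max x z - min x z) * (d - c) * M"
    using w assms(3-) unfolding divided_difference_bounded_def c_def d_def by auto
  moreover have "(max x z' - min x z') *\<^sub>R (w (max x z) - w (min x z)) -
      (max x z - min x z) *\<^sub>R (w (max x z') - w (min x z')) =
      (\<sigma> * \<tau>) *\<^sub>R ((z' - x) *\<^sub>R (w z - w x) - (z - x) *\<^sub>R (w z' - w x))"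
    by (auto simp: \<sigma>_def \<tau>_def min_def max_def algebra_simps)
  moreover have "\<bar>\<sigma> * \<tau>\<bar> = 1" by (auto simp: \<sigma>_def \<tau>_def)
  moreover have "max x z' - min x z' = \<bar>z' - x\<bar>" "max x z - min x z = \<bar>z - x\<bar>" by auto
  ultimately have "norm ((z' - x) *\<^sub>R (w z - w x) - (z - x) *\<^sub>R (w z' - w x))
    \<le> \<bar>z' - x\<bar> * \<bar>z - x\<bar> * (d - c) * M" by simp
  also have "\<dots> \<le> \<bar>z' - x\<bar> * \<bar>z - x\<bar> * (\<bar>z - x\<bar> + \<bar>z' - x\<bar>) * M"
    using M by (intro mult_right_mono mult_left_mono) (auto simp: c_def d_def)
  finally show ?thesis .
qed

text \<open>Slopes towards points tending to \<open>x\<close> form a Cauchy sequence, and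
  completeness supplies the derivative \<open>D\<close>. In the comparison with the slope towards a
  fixed \<open>z\<close>, the quadratic remainder is what survives the limit.\<close>

lemma taylor_of_divided_difference_bounded:
  fixes w :: "real \<Rightarrow> 'a::banach"
  assumes w: "divided_difference_bounded r M w" and M: "0 \<le> M" and r: "0 < r" and x: "x \<in> {0..r}"
  shows "\<exists>D. \<forall>z\<in>{0..r}. norm (w z - w x - (z - x) *\<^sub>R D) \<le> M * (z - x)\<^sup>2"
proof -
  \<comment> \<open>The approach stays in the interval: rightwards from \<open>x\<close> towards
    \<open>r\<close>, or leftwards towards 0 when x = r.\<close>
  define k where "k = (if x < r then r - x else - r)"
  define X where "X n = x + k * inverse (real (Suc n))" for n
  have k: "k \<noteq> 0" "x + k \<in> {0..r}" using x r by (auto simp: k_def)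
  have X: "X n \<in> {0..r}" "X n \<noteq> x" for n
  proof -
    have i: "0 < inverse (real (Suc n))" "inverse (real (Suc n)) \<le> 1" by (auto simp: inverse_le_1_iff)
    have "X n = (1 - inverse (real (Suc n))) *\<^sub>R x + inverse (real (Suc n)) *\<^sub>R (x + k)"
      by (simp add: X_def algebra_simps)
    also have "\<dots> \<in> {0..r}" using i x k(2) by (intro convexD[OF convex_real_interval(5)]) auto
    finally show "X n \<in> {0..r}" .
    show "X n \<noteq> x" using k by (simp add: X_def)
  qed
  define \<phi> where "\<phi> n = (1 / (X n - x)) *\<^sub>R (w (X n) - w x)" for n
  have b: "norm (w z - w x - (z - x) *\<^sub>R \<phi> n) \<le> \<bar>z - x\<bar> * (\<bar>z - x\<bar> + \<bar>X n - x\<bar>) * M"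
    if z: "z \<in> {0..r}" for z n
  proof -
    have "w (X n) - w x = (X n - x) *\<^sub>R \<phi> n" using X(2)[of n] by (simp add: \<phi>_def)
    then have "(X n - x) *\<^sub>R (w z - w x) - (z - x) *\<^sub>R (w (X n) - w x) =
        (X n - x) *\<^sub>R (w z - w x - (z - x) *\<^sub>R \<phi> n)"
      by (simp add: scaleR_diff_right mult.commute)
    with divided_difference_bounded_base_point[OF w M x z X(1)[of n]]
    have "\<bar>X n - x\<bar> * norm (w z - w x - (z - x) *\<^sub>R \<phi> n)
        \<le> \<bar>X n - x\<bar> * (\<bar>z - x\<bar> * (\<bar>z - x\<bar> + \<bar>X n - x\<bar>) * M)"
      by (simp add: mult.assoc)
    with X(2)[of n] show ?thesis by simp
  qed
  have Xlim: "(\<lambda>n. X n - x) \<longlonglongrightarrow> 0"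
    using tendsto_mult_right[OF LIMSEQ_inverse_real_of_nat, of k] by (simp add: X_def mult.commute)
  have \<phi>diff: "norm (\<phi> m - \<phi> n) \<le> (\<bar>X m - x\<bar> + \<bar>X n - x\<bar>) * M" for m n
  proof -
    have "w (X m) - w x = (X m - x) *\<^sub>R \<phi> m" using X(2)[of m] by (simp add: \<phi>_def)
    then have "w (X m) - w x - (X m - x) *\<^sub>R \<phi> n = (X m - x) *\<^sub>R (\<phi> m - \<phi> n)"
      by (simp add: scaleR_diff_right)
    with b[OF X(1)[of m], of n] have "\<bar>X m - x\<bar> * norm (\<phi> m - \<phi> n)
        \<le> \<bar>X m - x\<bar> * ((\<bar>X m - x\<bar> + \<bar>X n - x\<bar>) * M)" by (simp add: mult.assoc)
    with X(2)[of m] show ?thesis by simp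
  qed
  have "Cauchy \<phi>"
  proof (rule CauchyI)
    fix e :: real assume "0 < e"
    then have "0 < e / (2 * (M + 1))" using M by simp
    with Xlim obtain N where N: "\<And>n. N \<le> n \<Longrightarrow> \<bar>X n - x\<bar> < e / (2 * (M + 1))"
      unfolding LIMSEQ_iff by fastforce
    have "norm (\<phi> m - \<phi> n) < e" if "N \<le> m" "N \<le> n" for m n
    proof -
      have "norm (\<phi> m - \<phi> n) \<le> (\<bar>X m - x\<bar> + \<bar>X n - x\<bar>) * (M + 1)"
        by (rule order_trans[OF \<phi>diff[of m n]]) (simp add: mult_left_mono)
      also have "\<dots> < (e / (2 * (M + 1)) + e / (2 * (M + 1))) * (M + 1)"
        using N[OF that(1)] N[OF that(2)] M by (intro mult_strict_right_mono add_strict_mono) auto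
      also have "\<dots> = e"
      proof -
        have "(e / (2 * c) + e / (2 * c)) * c = e" if "0 < c" for c :: real
          using that by (simp add: field_simps)
        from this[of "M + 1"] M show ?thesis by linarith
      qed
      finally show ?thesis .
    qed
    then show "\<exists>N. \<forall>m\<ge>N. \<forall>n\<ge>N. norm (\<phi> m - \<phi> n) < e" by blast
  qed
  then obtain D where D: "\<phi> \<longlonglongrightarrow> D" using Cauchy_convergent convergent_def by blast
  have "norm (w z - w x - (z - x) *\<^sub>R D) \<le> M * (z - x)\<^sup>2" if z: "z \<in> {0..r}" for z
  proof (rule LIMSEQ_le)
    show "(\<lambda>n. norm (w z - w x - (z - x) *\<^sub>R \<phi> n)) \<longlonglongrightarrow> norm (w z - w x - (z - x) *\<^sub>R D)"
      by (intro tendsto_intros D)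
    have "(\<lambda>n. \<bar>z - x\<bar> * (\<bar>z - x\<bar> + \<bar>X n - x\<bar>) * M) \<longlonglongrightarrow> \<bar>z - x\<bar> * (\<bar>z - x\<bar> + \<bar>0\<bar>) * M"
      by (intro tendsto_intros Xlim)
    then show "(\<lambda>n. \<bar>z - x\<bar> * (\<bar>z - x\<bar> + \<bar>X n - x\<bar>) * M) \<longlonglongrightarrow> M * (z - x)\<^sup>2"
      by (simp add: power2_eq_square mult.commute)
  qed (use b[OF z] in blast)
  then show ?thesis by blast
qed

lemma has_vector_derivative_of_quadratic_error:
  assumes "\<And>z. z \<in> S \<Longrightarrow> norm (w z - w x - (z - x) *\<^sub>R D) \<le> M * (z - x)\<^sup>2" and M: "0 \<le> M"
  shows "(w has_vector_derivative D) (at x within S)"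
  unfolding has_vector_derivative_def has_derivative_within_alt
proof (intro conjI allI impI)
  fix e :: real assume "0 < e"
  show "\<exists>d>0. \<forall>y\<in>S. norm (y - x) < d \<longrightarrow> norm (w y - w x - (y - x) *\<^sub>R D) \<le> e * norm (y - x)"
  proof (intro exI[of _ "e / (M + 1)"] conjI ballI impI)
    fix y assume y: "y \<in> S" "norm (y - x) < e / (M + 1)"
    have "M * \<bar>y - x\<bar> \<le> (M + 1) * \<bar>y - x\<bar>" by (intro mult_right_mono) auto
    also have "\<dots> \<le> e" using y(2) M by (simp add: field_simps)
    finally have "M * \<bar>y - x\<bar> * \<bar>y - x\<bar> \<le> e * \<bar>y - x\<bar>" by (rule mult_right_mono) simp
    with assms(1)[OF y(1)] show "norm (w y - w x - (y - x) *\<^sub>R D) \<le> e * norm (y - x)"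
      by (simp add: power2_eq_square mult.assoc)
  qed (use \<open>0 < e\<close> M in auto)
qed (rule bounded_linear_scaleR_left)

lemma taylor_pd_x:
  fixes u :: "real \<Rightarrow> real \<Rightarrow> 'a::banach"
  assumes w: "divided_difference_bounded r M (\<lambda>s. u s y)" and M: "0 \<le> M" and r: "0 < r" and x: "x \<in> {0..r}"
  shows "((\<lambda>s. u s y) has_vector_derivative pd_x r u x y) (at x within {0..r})"
    and "z \<in> {0..r} \<Longrightarrow> norm (u z y - u x y - (z - x) *\<^sub>R pd_x r u x y) \<le> M * (z - x)\<^sup>2"
proof -
  obtain D where D: "\<And>z. z \<in> {0..r} \<Longrightarrow> norm (u z y - u x y - (z - x) *\<^sub>R D) \<le> M * (z - x)\<^sup>2"
    using taylor_of_divided_difference_bounded[OF w M r x] by blast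
  have d: "((\<lambda>s. u s y) has_vector_derivative D) (at x within {0..r})"
    by (rule has_vector_derivative_of_quadratic_error[OF D M])
  have "pd_x r u x y = D"
    unfolding pd_x_def using vector_derivative_within_cbox[of 0 r x, OF r] x d by simp
  with d D show "((\<lambda>s. u s y) has_vector_derivative pd_x r u x y) (at x within {0..r})"
    and "z \<in> {0..r} \<Longrightarrow> norm (u z y - u x y - (z - x) *\<^sub>R pd_x r u x y) \<le> M * (z - x)\<^sup>2" by auto
qed

lemma norm_diff_mono: "norm a \<le> c \<Longrightarrow> norm b \<le> d \<Longrightarrow> norm (a - b) \<le> c + d"
  using norm_triangle_ineq4[of a b] by linarith

text \<open>In x, Taylor expansions at both points give the Lipschitz constant 2 M. In y, both
  derivatives are replaced by slopes over one fixed length \<open>h\<close>, whose difference is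
  controlled by uniform continuity of \<open>u\<close>.\<close>

lemma continuous_on_square_pd_x:
  fixes u :: "real \<Rightarrow> real \<Rightarrow> 'a::banach"
  assumes w: "\<And>y. y \<in> {0..r} \<Longrightarrow> divided_difference_bounded r M (\<lambda>s. u s y)" and M: "0 \<le> M" and r: "0 < r"
    and u: "continuous_on (square r) (case_prod u)"
  shows "continuous_on (square r) (case_prod (pd_x r u))"
  unfolding continuous_on_iff
proof (intro ballI allI impI)
  let ?v = "pd_x r u"
  have T: "norm (u z y - u x y - (z - x) *\<^sub>R ?v x y) \<le> M * (z - x)\<^sup>2"
    if "y \<in> {0..r}" "x \<in> {0..r}" "z \<in> {0..r}" for x y z
    using taylor_pd_x(2)[where u = u and y = y] w[OF that(1)] M r that(2,3) by blast
  fix p :: "real \<times> real" and e :: real assume p: "p \<in> square r" and e: "0 < e"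
  obtain x y where xy: "p = (x, y)" "x \<in> {0..r}" "y \<in> {0..r}" using p by (auto simp: square_def)
  \<comment> \<open>The bound r / 2 leaves room on one side of every point; the other one makes the
    two remainders 2 M h at most e / 4. Increments of \<open>u\<close> are later divided by
    \<open>h\<close>, hence the tolerance e h / 8 below.\<close>
  define h where "h = min (r / 2) (e / (8 * (M + 1)))"
  have h: "0 < h" "h \<le> r / 2" "h \<le> e / (8 * (M + 1))" using e r M
    by (simp_all only: h_def min.cobounded1 min.cobounded2) simp
  have small: "2 * M * t \<le> e / 4" if "0 \<le> t" "t \<le> e / (8 * (M + 1))" for t
  proof -
    have "2 * M * t \<le> 2 * (M + 1) * t" using that by (intro mult_right_mono) auto
    also have "\<dots> \<le> e / 4" using that M by (simp add: field_simps)
    finally show ?thesis .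
  qed
  have "uniformly_continuous_on (square r) (case_prod u)"
    by (rule compact_uniformly_continuous[OF u compact_square])
  then obtain d where d: "0 < d"
    "\<And>p q. p \<in> square r \<Longrightarrow> q \<in> square r \<Longrightarrow> dist q p < d \<Longrightarrow> dist (case_prod u q) (case_prod u p) < e * h / 8"
    using e h(1) unfolding uniformly_continuous_on_def by (metis divide_pos_pos mult_pos_pos zero_less_numeral)
  show "\<exists>d>0. \<forall>q\<in>square r. dist q p < d \<longrightarrow> dist (case_prod ?v q) (case_prod ?v p) < e"
  proof (intro exI[of _ "min d (e / (8 * (M + 1)))"] conjI ballI impI)
    fix q assume q: "q \<in> square r" "dist q p < min d (e / (8 * (M + 1)))"
    obtain x' y' where xy': "q = (x', y')" "x' \<in> {0..r}" "y' \<in> {0..r}" using q by (auto simp: square_def)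
    have dx: "\<bar>x' - x\<bar> \<le> e / (8 * (M + 1))" and dy: "\<bar>y' - y\<bar> < d"
      using q(2) xy xy' dist_fst_le[of q p] dist_snd_le[of q p] by (auto simp: dist_real_def)
    have 1: "norm (?v x' y - ?v x y) \<le> e / 4"
    proof (cases "x' = x")
      case False
      have "(x' - x) *\<^sub>R (?v x' y - ?v x y) =
          (u x' y - u x y - (x' - x) *\<^sub>R ?v x y) + (u x y - u x' y - (x - x') *\<^sub>R ?v x' y)"
        by (simp add: algebra_simps)
      also have "norm \<dots> \<le> M * (x' - x)\<^sup>2 + M * (x - x')\<^sup>2"
        by (intro norm_triangle_mono T xy xy')
      also have "\<dots> = \<bar>x' - x\<bar> * (2 * M * \<bar>x' - x\<bar>)"
        by (cases "x \<le> x'") (simp_all add: power2_eq_square algebra_simps)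
      finally have "\<bar>x' - x\<bar> * norm (?v x' y - ?v x y) \<le> \<bar>x' - x\<bar> * (2 * M * \<bar>x' - x\<bar>)"
        by simp
      with False have "norm (?v x' y - ?v x y) \<le> 2 * M * \<bar>x' - x\<bar>" by simp
      with small[OF _ dx] show ?thesis by simp
    qed (use e in simp)
    have 2: "norm (?v x' y' - ?v x' y) \<le> e / 2"
    proof -
      obtain z where z: "z \<in> {0..r}" "\<bar>z - x'\<bar> = h"
      proof (cases "x' \<le> r / 2")
        case True
        then show ?thesis using that[of "x' + h"] h xy'(2) by auto
      next
        case False
        then show ?thesis using that[of "x' - h"] h xy'(2) by auto
      qed
      have near: "norm (u s y' - u s y) \<le> e * h / 8" if "s \<in> {0..r}" for s
        using d(2)[of "(s, y)" "(s, y')"] that xy(3) xy'(3) dy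
        by (simp add: square_def dist_Pair_Pair dist_norm)
      have "(z - x') *\<^sub>R (?v x' y' - ?v x' y) =
          (u z y - u x' y - (z - x') *\<^sub>R ?v x' y) - (u z y' - u x' y' - (z - x') *\<^sub>R ?v x' y')
          + ((u z y' - u z y) - (u x' y' - u x' y))"
        by (simp add: algebra_simps)
      also have "norm \<dots> \<le> (M * (z - x')\<^sup>2 + M * (z - x')\<^sup>2) + (e * h / 8 + e * h / 8)"
        by (intro norm_triangle_mono norm_diff_mono T near z xy xy')
      finally have "h * norm (?v x' y' - ?v x' y) \<le> 2 * M * h\<^sup>2 + e * h / 4"
        using z(2) by (simp flip: power2_abs[of "z - x'"])
      also have "\<dots> = h * (2 * M * h + e / 4)" by (simp add: power2_eq_square algebra_simps)
      finally have "norm (?v x' y' - ?v x' y) \<le> 2 * M * h + e / 4" using h(1) by simp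
      with small[of h] h show ?thesis by simp
    qed
    show "dist (case_prod ?v q) (case_prod ?v p) < e"
      using 1 2 norm_triangle_ineq[of "?v x' y' - ?v x' y" "?v x' y - ?v x y"] e
      by (simp add: xy xy' dist_norm)
  qed (use d e M in auto)
qed

text \<open>Convergence of \<open>U\<close> cannot be divided by the mesh size, so the quotient is
  compared with the slope over a block of length about \<open>h0\<close>, fixed before the
  mesh.\<close>

lemma grid_limit_dq_x:
  fixes u :: "real \<Rightarrow> real \<Rightarrow> 'a::banach"
  assumes w: "\<And>y. y \<in> {0..r} \<Longrightarrow> divided_difference_bounded r M (\<lambda>s. u s y)" and M: "0 \<le> M" and r: "0 < r"
    and lim: "grid_limit e0 r l U u"
    and U: "\<forall>\<^sub>F h in at 0 within mesh e0. dq_bounded h 2 (grid_square h (r - real l * h)) M (U h)"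
  shows "grid_limit e0 r (Suc l) (\<lambda>h. dq_x h (U h)) (pd_x r u)"
  unfolding grid_limit_def
proof (intro allI impI)
  let ?v = "pd_x r u"
  have T: "norm (u z y - u x y - (z - x) *\<^sub>R ?v x y) \<le> M * (z - x)\<^sup>2"
    if "y \<in> {0..r}" "x \<in> {0..r}" "z \<in> {0..r}" for x y z
    using taylor_pd_x(2)[where u = u and y = y] w[OF that(1)] M r that(2,3) by blast
  fix e :: real assume e: "0 < e"
  \<comment> \<open>With r / 4 a block always fits into [0, R], since R is at least r / 2; the
    second bound keeps three remainders together at most 3 e / 8.\<close>
  define h0 where "h0 = min (r / 4) (e / (8 * (M + 1)))"
  have h0: "0 < h0" "h0 \<le> r / 4" "h0 \<le> e / (8 * (M + 1))" using e r M
    by (simp_all only: h0_def min.cobounded1 min.cobounded2) simp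
  have "3 * M * h0 \<le> 3 * (M + 1) * h0" using h0(1) by (intro mult_right_mono) auto
  also have "\<dots> \<le> 3 * e / 8" using h0(3) M by (simp add: field_simps)
  finally have small: "3 * M * h0 \<le> 3 * e / 8" .
  \<comment> \<open>Both block ends contribute, in total e h0 / 8 = (e / 4) (h0 / 2), which is at
    most e / 4 times the block length.\<close>
  have "0 < e * h0 / 16" using e h0 by simp
  with lim have close: "\<forall>\<^sub>F h in at 0 within mesh e0. \<forall>x y. (x, y) \<in> grid_square h (r - real l * h) \<longrightarrow>
       norm (U h x y - u x y) < e * h0 / 16"
    unfolding grid_limit_def by blast
  have half: "\<forall>\<^sub>F h in at 0 within mesh e0. real l * h \<le> r / 2"
    using r by (intro eventually_mesh_mult_le) simp
  show "\<forall>\<^sub>F h in at 0 within mesh e0. \<forall>x y. (x, y) \<in> grid_square h (r - real (Suc l) * h) \<longrightarrow>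
       norm (dq_x h (U h) x y - ?v x y) < e"
    using close U eventually_mesh half eventually_mesh_less[OF h0(1)]
  proof eventually_elim
    case (elim h)
    show ?case
    proof (intro allI impI)
      fix x y assume xy: "(x, y) \<in> grid_square h (r - real (Suc l) * h)"
      have h: "0 < h" using elim(3) by (rule mesh_pos)
      define R where "R = r - real l * h"
      have R: "r / 2 \<le> R" "R \<le> r" using elim(4) h by (auto simp: R_def)
      have R': "r - real (Suc l) * h = R - h" by (simp add: R_def algebra_simps)
      obtain i where i: "x = real i * h" "x \<le> R - h"
        using xy grid_iff_nat[OF h, of x "R - h"] unfolding R' grid_square_def by auto
      have y: "y \<in> grid h R" using xy grid_mono[of "R - h" R h] h unfolding R' grid_square_def by auto
      define H where "H = nat \<lfloor>h0 / h\<rfloor>"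
      have "1 \<le> h0 / h" using elim(5) h by simp
      then have f: "1 \<le> \<lfloor>h0 / h\<rfloor>" by simp
      have "of_int \<lfloor>h0 / h\<rfloor> * h \<le> h0" "h0 < (of_int \<lfloor>h0 / h\<rfloor> + 1) * h"
        using h floor_correct[of "h0 / h"] by (simp_all add: pos_le_divide_eq[symmetric] pos_divide_less_eq[symmetric])
      moreover have "real H = of_int \<lfloor>h0 / h\<rfloor>" using f by (simp add: H_def)
      ultimately have H: "real H * h \<le> h0" "h0 < real H * h + h" by (simp_all add: distrib_right)
      have H1: "1 \<le> H" unfolding H_def using f by linarith
      have "h \<le> real H * h" using H1 h by simp
      with H(2) have H2: "h0 / 2 \<le> real H * h" by simp
      \<comment> \<open>The block of \<open>H\<close> steps must contain the edge from
        \<open>i\<close> to i + 1: it starts at \<open>i\<close> if there is room on the right, and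
        otherwise ends at i + 1.\<close>
      obtain p where p: "p \<le> i" "i + 1 \<le> p + H" "real (p + H) * h \<le> R"
      proof (cases "real (i + H) * h \<le> R")
        case True
        then show ?thesis using that[of i] H1 by simp
      next
        case False
        then have "R - real H * h < real i * h" by (simp add: algebra_simps)
        with H(1) h0 R have "real H * h < real i * h" by linarith
        with h have "H < i" by simp
        then have "i + 1 - H + H = i + 1" by simp
        moreover have "real (i + 1) * h \<le> R" using i by (simp add: algebra_simps)
        ultimately show ?thesis using that[of "i + 1 - H"] \<open>H < i\<close> H1 by auto
      qed
      let ?P = "real p * h" and ?Q = "real (p + H) * h"
      have QP: "?Q - ?P = real H * h" by (simp add: algebra_simps)
      have xh: "real (i + 1) * h = x + h" "real (i + 1) * h - x = h" using i by (simp_all add: algebra_simps)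
      have ord: "0 \<le> ?P" "?P \<le> x" "x \<le> ?Q" "?Q \<le> R"
      proof -
        have "real i * h \<le> real (p + H) * h" using p(2) h by (intro mult_right_mono) auto
        then show "0 \<le> ?P" "?P \<le> x" "x \<le> ?Q" "?Q \<le> R" using p h i by auto
      qed
      have "norm ((real (i + 1) * h - real i * h) *\<^sub>R (U h ?Q y - U h ?P y) -
          (?Q - ?P) *\<^sub>R (U h (real (i + 1) * h) y - U h (real i * h) y))
        \<le> (real (i + 1) * h - real i * h) * (?Q - ?P) * (?Q - ?P) * M"
        by (rule discrete_divided_difference_bound[OF h elim(2)[folded R_def] M]) (use p y in auto)
      then have "norm (h *\<^sub>R (U h ?Q y - U h ?P y) - (?Q - ?P) *\<^sub>R (U h (x + h) y - U h x y))
        \<le> h * (?Q - ?P) * (?Q - ?P) * M"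
        unfolding i(1)[symmetric] xh(2) unfolding xh(1) .
      moreover have "U h (x + h) y - U h x y = h *\<^sub>R dq_x h (U h) x y"
        using h by (simp add: dq_x_def)
      ultimately have "norm (h *\<^sub>R (U h ?Q y - U h ?P y) - (?Q - ?P) *\<^sub>R (h *\<^sub>R dq_x h (U h) x y))
        \<le> h * (M * (?Q - ?P)\<^sup>2)"
        by (simp add: power2_eq_square mult_ac)
      moreover have "h *\<^sub>R (U h ?Q y - U h ?P y) - (?Q - ?P) *\<^sub>R (h *\<^sub>R dq_x h (U h) x y) =
          h *\<^sub>R (U h ?Q y - U h ?P y - (?Q - ?P) *\<^sub>R dq_x h (U h) x y)"
        by (simp only: scaleR_diff_right scaleR_scaleR mult.commute)
      ultimately have A: "norm (U h ?Q y - U h ?P y - (?Q - ?P) *\<^sub>R dq_x h (U h) x y) \<le> M * (?Q - ?P)\<^sup>2"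
        using h by simp
      have mem: "x \<in> {0..r}" "?P \<in> {0..r}" "?Q \<in> {0..r}" "y \<in> {0..r}"
        using ord R grid_bounds[OF y] by auto
      have sq: "M * (?Q - x)\<^sup>2 \<le> M * (?Q - ?P)\<^sup>2" "M * (?P - x)\<^sup>2 \<le> M * (?Q - ?P)\<^sup>2"
        using ord M by (auto intro!: mult_left_mono simp: abs_le_square_iff[symmetric])
      have B: "norm (u ?Q y - u x y - (?Q - x) *\<^sub>R ?v x y) \<le> M * (?Q - ?P)\<^sup>2"
        "norm (u ?P y - u x y - (?P - x) *\<^sub>R ?v x y) \<le> M * (?Q - ?P)\<^sup>2"
        using T[OF mem(4,1,3)] T[OF mem(4,1,2)] sq by linarith+
      have "(?P, y) \<in> grid_square h R" "(?Q, y) \<in> grid_square h R"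
        using y ord by (auto simp: grid_square_def grid_iff_nat[OF h] simp del: of_nat_add)
      then have D: "norm (U h ?P y - u ?P y) \<le> e * h0 / 16" "norm (U h ?Q y - u ?Q y) \<le> e * h0 / 16"
        using elim(1) unfolding R_def[symmetric] by (auto intro: less_imp_le)
      \<comment> \<open>Two Taylor remainders of \<open>u\<close>, one remainder of the discrete
        slope, and the errors of \<open>U\<close> at the two block ends.\<close>
      have eq: "(?Q - ?P) *\<^sub>R (dq_x h (U h) x y - ?v x y) =
         ((u ?Q y - u x y - (?Q - x) *\<^sub>R ?v x y) - (u ?P y - u x y - (?P - x) *\<^sub>R ?v x y)
         - (U h ?Q y - U h ?P y - (?Q - ?P) *\<^sub>R dq_x h (U h) x y))
         + ((U h ?Q y - u ?Q y) - (U h ?P y - u ?P y))"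
        by (simp add: algebra_simps)
      have "norm ((?Q - ?P) *\<^sub>R (dq_x h (U h) x y - ?v x y))
          \<le> ((M * (?Q - ?P)\<^sup>2 + M * (?Q - ?P)\<^sup>2) + M * (?Q - ?P)\<^sup>2) + (e * h0 / 16 + e * h0 / 16)"
        unfolding eq by (rule norm_triangle_mono[OF norm_diff_mono[OF norm_diff_mono[OF B] A] norm_diff_mono[OF D(2,1)]])
      then have "(real H * h) * norm (dq_x h (U h) x y - ?v x y) \<le> 3 * (M * (real H * h)\<^sup>2) + e * h0 / 8"
        unfolding QP norm_scaleR using h by (subst (asm) abs_of_nonneg) (simp, linarith)
      also have "\<dots> \<le> (real H * h) * (3 * M * h0 + e / 4)"
      proof -
        have "3 * (M * (real H * h)\<^sup>2) = (real H * h) * (3 * M * (real H * h))" by (simp add: power2_eq_square)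
        also have "\<dots> \<le> (real H * h) * (3 * M * h0)" using H(1) M h by (intro mult_left_mono) auto
        finally have "3 * (M * (real H * h)\<^sup>2) \<le> (real H * h) * (3 * M * h0)" .
        moreover have "e / 4 * (h0 / 2) \<le> e / 4 * (real H * h)" using H2 e by (intro mult_left_mono) auto
        ultimately show ?thesis by (simp add: algebra_simps)
      qed
      finally have "norm (dq_x h (U h) x y - ?v x y) \<le> 3 * M * h0 + e / 4"
        using h H1 by (subst (asm) mult_le_cancel_left_pos) auto
      with small e show "norm (dq_x h (U h) x y - ?v x y) < e" by linarith
    qed
  qed
qed

lemma grid_limit_derivative_x:
  fixes u :: "real \<Rightarrow> real \<Rightarrow> 'a::banach"
  assumes e0: "0 < e0" and r: "0 < r" and u: "continuous_on (square r) (case_prod u)"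
    and lim: "grid_limit e0 r l U u"
    and U: "\<forall>\<^sub>F h in at 0 within mesh e0. dq_bounded h 2 (grid_square h (r - real l * h)) M (U h)"
  shows "grid_limit e0 r (Suc l) (\<lambda>h. dq_x h (U h)) (pd_x r u)"
    and "continuous_on (square r) (case_prod (pd_x r u))"
    and "(x, y) \<in> square r \<Longrightarrow> (\<lambda>s. u s y) differentiable (at x within {0..r})"
proof -
  have U': "\<forall>\<^sub>F h in at 0 within mesh e0. dq_bounded h 2 (grid_square h (r - real l * h)) \<bar>M\<bar> (U h)"
    using U by eventually_elim (erule dq_bounded_mono, auto)
  have w: "divided_difference_bounded r \<bar>M\<bar> (\<lambda>s. u s y)" if "y \<in> {0..r}" for y
    unfolding divided_difference_bounded_def
    using limit_divided_difference_bound[OF e0 lim u r U' abs_ge_zero] that by auto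
  show "grid_limit e0 r (Suc l) (\<lambda>h. dq_x h (U h)) (pd_x r u)"
    by (rule grid_limit_dq_x[OF _ abs_ge_zero r lim U']) (rule w)
  show "continuous_on (square r) (case_prod (pd_x r u))"
    by (rule continuous_on_square_pd_x[OF _ abs_ge_zero r u]) (rule w)
  show "(\<lambda>s. u s y) differentiable (at x within {0..r})" if "(x, y) \<in> square r"
    using taylor_pd_x(1)[where u = u and y = y and x = x, OF w abs_ge_zero r] that
    by (auto simp: square_def intro: differentiableI_vector)
qed

section \<open>Exchange of the variables and induction on the order of differentiation\<close>

lemma grid_limit_flip: "grid_limit e0 r l U u \<Longrightarrow> grid_limit e0 r l (\<lambda>h x y. U h y x) (\<lambda>x y. u y x)"
  unfolding grid_limit_def
  by (elim all_forward imp_forward asm_rl) (elim eventually_mono, auto simp: grid_square_def)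

lemma continuous_on_square_flip:
  "continuous_on (square r) (case_prod u) \<Longrightarrow> continuous_on (square r) (case_prod (\<lambda>x y. u y x))"
proof -
  assume u: "continuous_on (square r) (case_prod u)"
  have "continuous_on (square r) (\<lambda>p. case_prod u (prod.swap p))"
    by (rule continuous_on_compose2[OF u continuous_on_swap]) (auto simp: square_def)
  then show ?thesis by (simp add: case_prod_beta')
qed

lemma grid_limit_derivative_y:
  fixes u :: "real \<Rightarrow> real \<Rightarrow> 'a::banach"
  assumes e0: "0 < e0" and r: "0 < r" and u: "continuous_on (square r) (case_prod u)"
    and lim: "grid_limit e0 r l U u"
    and U: "\<forall>\<^sub>F h in at 0 within mesh e0. dq_bounded h 2 (grid_square h (r - real l * h)) M (U h)"
  shows "grid_limit e0 r (Suc l) (\<lambda>h. dq_y h (U h)) (pd_y r u)"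
    and "continuous_on (square r) (case_prod (pd_y r u))"
    and "(x, y) \<in> square r \<Longrightarrow> (\<lambda>t. u x t) differentiable (at y within {0..r})"
proof -
  have U': "\<forall>\<^sub>F h in at 0 within mesh e0. dq_bounded h 2 (grid_square h (r - real l * h)) M (\<lambda>x y. U h y x)"
    using U by eventually_elim (drule dq_bounded_flipI, simp only: grid_square_swap)
  note x = grid_limit_derivative_x[OF e0 r continuous_on_square_flip[OF u] grid_limit_flip[OF lim] U']
  have pd: "pd_x r (\<lambda>x y. u y x) = (\<lambda>x y. pd_y r u y x)" by (simp add: pd_x_def pd_y_def)
  show "grid_limit e0 r (Suc l) (\<lambda>h. dq_y h (U h)) (pd_y r u)"
    using grid_limit_flip[OF x(1)] unfolding pd dq_x_flip[of _ "U _"] .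
  show "continuous_on (square r) (case_prod (pd_y r u))"
    using continuous_on_square_flip[OF x(2)] unfolding pd .
  show "(\<lambda>t. u x t) differentiable (at y within {0..r})" if "(x, y) \<in> square r"
    using x(3)[where x = y and y = x] that by (simp add: square_def)
qed

lemma grid_limit_mono:
  assumes "grid_limit e0 r l U u" "l \<le> l'"
  shows "grid_limit e0 r l' U u"
  unfolding grid_limit_def
proof (intro allI impI)
  fix e :: real assume "0 < e"
  with assms have "\<forall>\<^sub>F h in at 0 within mesh e0. \<forall>x y. (x, y) \<in> grid_square h (r - real l * h) \<longrightarrow>
       norm (U h x y - u x y) < e"
    unfolding grid_limit_def by blast
  with eventually_mesh
  show "\<forall>\<^sub>F h in at 0 within mesh e0. \<forall>x y. (x, y) \<in> grid_square h (r - real l' * h) \<longrightarrow>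
       norm (U h x y - u x y) < e"
  proof eventually_elim
    case (elim h)
    have "real l * h \<le> real l' * h" using assms(2) mesh_pos[OF elim(1)] by simp
    then have "grid h (r - real l' * h) \<subseteq> grid h (r - real l * h)" by (intro grid_mono) simp
    with elim(2) show ?case unfolding grid_square_def by blast
  qed
qed

lemma grid_square_subset_dom:
  assumes "0 < h"
  shows "grid_square h (R - h) \<subseteq> dom_x h (grid_square h R)" "grid_square h (R - h) \<subseteq> dom_y h (grid_square h R)"
proof -
  have "x \<in> grid h R" "x + h \<in> grid h R" if "x \<in> grid h (R - h)" for x
    using grid_mono[of "R - h" R h] grid_add[OF assms that, of 1 R] grid_bounds[OF that] assms that by auto
  then show "grid_square h (R - h) \<subseteq> dom_x h (grid_square h R)" "grid_square h (R - h) \<subseteq> dom_y h (grid_square h R)"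
    by (auto simp: grid_square_def dom_x_def dom_y_def)
qed

text \<open>The quotients of \<open>U\<close> with the derivatives of \<open>u\<close> satisfy the
  same hypotheses with \<open>k\<close> lowered and \<open>l\<close> raised by one. The order
  \<open>Suc k\<close> keeps second quotients available as long as a derivative is still to be
  taken.\<close>

lemma C_k_square_of_grid_limit:
  fixes u :: "real \<Rightarrow> real \<Rightarrow> 'a::banach"
  assumes e0: "0 < e0" and r: "0 < r" and u: "continuous_on (square r) (case_prod u)"
    and "grid_limit e0 r l U u"
    and "\<forall>\<^sub>F h in at 0 within mesh e0. dq_bounded h (Suc k) (grid_square h (r - real l * h)) M (U h)"
  shows "C_k_square k r u \<and> (\<forall>m n. m + n \<le> k \<longrightarrow>
    grid_limit e0 r (l + k) (\<lambda>h. (dq_x h ^^ m) ((dq_y h ^^ n) (U h))) ((pd_x r ^^ m) ((pd_y r ^^ n) u)))"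
  using u assms(4,5)
proof (induction k arbitrary: u U l)
  case 0
  then show ?case by simp
next
  case (Suc k)
  have U2: "\<forall>\<^sub>F h in at 0 within mesh e0. dq_bounded h 2 (grid_square h (r - real l * h)) M (U h)"
    using Suc.prems(3) by eventually_elim (erule dq_bounded_mono, auto)
  note x = grid_limit_derivative_x[OF e0 r Suc.prems(1,2) U2]
  note y = grid_limit_derivative_y[OF e0 r Suc.prems(1,2) U2]
  have R: "r - real (Suc l) * h = (r - real l * h) - h" for h by (simp add: algebra_simps)
  have Ux: "\<forall>\<^sub>F h in at 0 within mesh e0. dq_bounded h (Suc k) (grid_square h (r - real (Suc l) * h)) M (dq_x h (U h))"
    using Suc.prems(3) eventually_mesh
  proof eventually_elim
    case (elim h)
    from elim(1) have "dq_bounded h (Suc k) (dom_x h (grid_square h (r - real l * h))) M (dq_x h (U h))"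
      unfolding dq_bounded.simps(2)[of h "Suc k"] by blast
    from dq_bounded_mono[OF this grid_square_subset_dom(1)[OF mesh_pos[OF elim(2)]] order_refl order_refl]
    show ?case unfolding R .
  qed
  have Uy: "\<forall>\<^sub>F h in at 0 within mesh e0. dq_bounded h (Suc k) (grid_square h (r - real (Suc l) * h)) M (dq_y h (U h))"
    using Suc.prems(3) eventually_mesh
  proof eventually_elim
    case (elim h)
    from elim(1) have "dq_bounded h (Suc k) (dom_y h (grid_square h (r - real l * h))) M (dq_y h (U h))"
      unfolding dq_bounded.simps(2)[of h "Suc k"] by blast
    from dq_bounded_mono[OF this grid_square_subset_dom(2)[OF mesh_pos[OF elim(2)]] order_refl order_refl]
    show ?case unfolding R .
  qed
  note IHx = Suc.IH[OF x(2,1) Ux] and IHy = Suc.IH[OF y(2,1) Uy]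
  \<comment> \<open>The innermost operator is peeled off, \<open>dq_y\<close> if present and
    \<open>dq_x\<close> otherwise, because the induction hypothesis concerns quotients of U's first
    quotient; if none is left, only the grid shrinks.\<close>
  have "grid_limit e0 r (l + Suc k) (\<lambda>h. (dq_x h ^^ m) ((dq_y h ^^ n) (U h))) ((pd_x r ^^ m) ((pd_y r ^^ n) u))"
    if mn: "m + n \<le> Suc k" for m n
  proof (cases n)
    case (Suc n')
    with IHy mn show ?thesis by (simp add: funpow_swap1)
  next
    case 0
    show ?thesis
    proof (cases m)
      case 0
      with \<open>n = 0\<close> show ?thesis using grid_limit_mono[OF Suc.prems(2), of "l + Suc k"] by simp
    next
      case (Suc m')
      with IHx[THEN conjunct2, rule_format, of m' 0] mn \<open>n = 0\<close> show ?thesis by (simp add: funpow_swap1)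
    qed
  qed
  moreover have "C_k_square (Suc k) r u"
    using Suc.prems(1) x(3) y(3) IHx IHy by auto
  ultimately show ?case by blast
qed

text \<open>Strict bounds pass to a supremum only weakly, hence e / 2. On fine meshes the point (0,
  0) keeps the index set nonempty, so the supremum is a genuine one.\<close>

lemma tendsto_SUP_of_grid_limit:
  assumes "grid_limit e0 r l V v" "0 < r"
  shows "((\<lambda>h. SUP (x, y)\<in>grid_square h (r - real l * h). norm (V h x y - v x y)) \<longlongrightarrow> 0) (at 0 within mesh e0)"
proof (rule tendstoI)
  fix e :: real assume "0 < e"
  then have "0 < e / 2" by simp
  with assms(1) have "\<forall>\<^sub>F h in at 0 within mesh e0. \<forall>x y. (x, y) \<in> grid_square h (r - real l * h) \<longrightarrow>
       norm (V h x y - v x y) < e / 2"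
    unfolding grid_limit_def by blast
  then show "\<forall>\<^sub>F h in at 0 within mesh e0.
      dist (SUP (x, y)\<in>grid_square h (r - real l * h). norm (V h x y - v x y)) 0 < e"
    using eventually_mesh_mult_le[OF assms(2), of "real l"]
  proof eventually_elim
    case (elim h)
    let ?S = "grid_square h (r - real l * h)" and ?f = "\<lambda>(x, y). norm (V h x y - v x y)"
    have le: "?f p \<le> e / 2" if "p \<in> ?S" for p
      using elim(1) that by (cases p) (auto intro: less_imp_le)
    have z: "(0, 0) \<in> ?S" using elim(2) by (simp add: grid_square_def zero_mem_grid)
    have "(SUP p\<in>?S. ?f p) \<le> e / 2" using z le by (intro cSUP_least) auto
    moreover have "bdd_above (?f ` ?S)" by (rule bdd_aboveI2[OF le])
    from cSUP_upper[OF z this] have "0 \<le> (SUP p\<in>?S. ?f p)" by (rule order_trans[rotated]) simp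
    ultimately show ?case using \<open>0 < e\<close> by (simp add: dist_real_def)
  qed
qed

section \<open>Convergence of the solutions\<close>

lemma deriv_bound_const_mono:
  assumes "deriv_bound f n K C" "C \<le> C'"
  shows "deriv_bound f n K C'"
  unfolding deriv_bound_def
proof (intro ballI allI impI)
  fix z and vs :: "'a list" assume *: "z \<in> K" "length vs \<le> n"
  have "0 \<le> prod_list (map norm vs)" by (induction vs) auto
  then have "C * prod_list (map norm vs) \<le> C' * prod_list (map norm vs)"
    by (rule mult_right_mono[OF assms(2)])
  with deriv_boundD[OF assms(1) *] show "norm (iter_deriv f vs z) \<le> C' * prod_list (map norm vs)" by linarith
qed

lemma discrete_goursat_solution_mono:
  "discrete_goursat_solution h r f g a0 b0 a b \<Longrightarrow> r' \<le> r \<Longrightarrow> discrete_goursat_solution h r' f g a0 b0 a b"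
  using subsetD[OF grid_mono[of r' r h]] by (simp add: discrete_goursat_solution_def)

lemma mesh_le_1: "h \<in> mesh e0 \<Longrightarrow> h \<le> 1"
  by (auto simp: mesh_def)

lemma grid_function_bounded:
  fixes U :: "real \<Rightarrow> real \<Rightarrow> real \<Rightarrow> 'a::real_normed_vector"
  assumes u: "continuous_on (square r) (case_prod u)"
    and close: "\<And>h x y. h \<in> mesh e0 \<Longrightarrow> (x, y) \<in> grid_square h r \<Longrightarrow> norm (U h x y - u x y) \<le> C * h"
  shows "\<exists>B. \<forall>h\<in>mesh e0. dq_bounded h 0 (grid_square h r) B (U h)"
proof -
  have "bounded (case_prod u ` square r)"
    by (intro compact_imp_bounded compact_continuous_image u compact_square)
  then obtain B where "\<forall>v\<in>case_prod u ` square r. norm v \<le> B"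
    unfolding bounded_iff by blast
  then have B: "norm (u x y) \<le> B" if "(x, y) \<in> square r" for x y using that by force
  have "norm (U h x y) \<le> B + \<bar>C\<bar>" if "h \<in> mesh e0" "(x, y) \<in> grid_square h r" for h x y
  proof -
    have "C * h \<le> \<bar>C\<bar> * 1" using mesh_pos[OF that(1)] mesh_le_1[OF that(1)] by (intro mult_mono) auto
    with close[OF that] B[of x y] grid_square_subset[of h r] that norm_triangle_sub[of "U h x y" "u x y"]
    show ?thesis by fastforce
  qed
  then show ?thesis by auto
qed

text \<open>Induction on \<open>s\<close>, started by the convergence itself. The compact set
  \<open>K\<close> depends only on the values and is the same at each order; the range of admissible
  meshes may shrink with \<open>s\<close>.\<close>

lemma eventually_dq_bounded_solution:
  fixes f g :: "'a::banach \<times> 'a \<Rightarrow> 'a"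
  assumes f: "C_k n f" "C_k_limit n F f (at 0 within mesh e0)" "\<And>h. h \<in> mesh e0 \<Longrightarrow> C_infinity (F h)"
    and g: "C_k n g" "C_k_limit n G g (at 0 within mesh e0)" "\<And>h. h \<in> mesh e0 \<Longrightarrow> C_infinity (G h)"
    and a: "continuous_on (square r) (case_prod a)"
      "\<And>h x y. h \<in> mesh e0 \<Longrightarrow> (x, y) \<in> grid_square h r \<Longrightarrow> norm (A h x y - a x y) \<le> Ca * h"
    and b: "continuous_on (square r) (case_prod b)"
      "\<And>h x y. h \<in> mesh e0 \<Longrightarrow> (x, y) \<in> grid_square h r \<Longrightarrow> norm (B h x y - b x y) \<le> Cb * h"
    and sol: "\<And>h. h \<in> mesh e0 \<Longrightarrow> discrete_goursat_solution h r (F h) (G h) (a0 h) (b0 h) (A h) (B h)"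
    and a0: "\<And>h m x. h \<in> mesh e0 \<Longrightarrow> m \<le> n \<Longrightarrow> x \<in> grid h r \<Longrightarrow> x + real m * h \<in> grid h r \<Longrightarrow>
      norm ((dq h ^^ m) (a0 h) x) \<le> M"
    and b0: "\<And>h m x. h \<in> mesh e0 \<Longrightarrow> m \<le> n \<Longrightarrow> x \<in> grid h r \<Longrightarrow> x + real m * h \<in> grid h r \<Longrightarrow>
      norm ((dq h ^^ m) (b0 h) x) \<le> M"
    and "s \<le> n"
  shows "\<exists>C. \<forall>\<^sub>F h in at 0 within mesh e0.
    dq_bounded h s (grid_square h r) C (A h) \<and> dq_bounded h s (grid_square h r) C (B h)"
  using \<open>s \<le> n\<close>
proof (induction s)
  case 0
  obtain C C' where C: "\<forall>h\<in>mesh e0. dq_bounded h 0 (grid_square h r) C (A h)"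
    "\<forall>h\<in>mesh e0. dq_bounded h 0 (grid_square h r) C' (B h)"
    using grid_function_bounded[OF a] grid_function_bounded[OF b] by blast
  have "\<forall>\<^sub>F h in at 0 within mesh e0. dq_bounded h 0 (grid_square h r) (max C C') (A h) \<and>
      dq_bounded h 0 (grid_square h r) (max C C') (B h)"
    using eventually_mesh by eventually_elim (use C in \<open>auto intro: max.coboundedI1 max.coboundedI2\<close>)
  then show ?case by blast
next
  case (Suc s)
  let ?F = "at 0 within mesh e0" and ?D = "\<lambda>h. grid_square h r"
  have "continuous_on (square r) (\<lambda>p. (case_prod a p, case_prod b p))"
    by (intro continuous_on_Pair a b)
  then have ab: "continuous_on (square r) (case_prod (\<lambda>x y. (a x y, b x y)))"
    by (simp add: case_prod_beta')
  have "norm ((A h x y, B h x y) - (a x y, b x y)) \<le> (Ca + Cb) * h"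
    if "h \<in> mesh e0" "(x, y) \<in> ?D h" for h x y
    using a(2)[OF that] b(2)[OF that] norm_Pair_le[of "A h x y - a x y" "B h x y - b x y"]
    by (simp add: distrib_right)
  then obtain K where K: "compact K" "\<And>h. h \<in> mesh e0 \<Longrightarrow> hull_of (?D h) (\<lambda>x y. (A h x y, B h x y)) \<subseteq> K"
    using grid_values_in_compact_convex[OF ab, of e0 "\<lambda>h x y. (A h x y, B h x y)" "Ca + Cb"] by blast
  obtain Cf Cg where C: "\<forall>\<^sub>F h in ?F. deriv_bound (F h) n K Cf" "\<forall>\<^sub>F h in ?F. deriv_bound (G h) n K Cg"
    using eventually_deriv_bound[OF f K(1)] eventually_deriv_bound[OF g K(1)] by blast
  obtain C0 where C0: "\<forall>\<^sub>F h in ?F. dq_bounded h s (?D h) C0 (A h) \<and> dq_bounded h s (?D h) C0 (B h)"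
    using Suc by auto
  \<comment> \<open>The 1 meets the requirement of the order step, and twice C0 bounds the pair,
    whose bound is the sum of those of its components.\<close>
  define C1 where "C1 = 1 + 2 * \<bar>C0\<bar> + \<bar>Cf\<bar> + \<bar>Cg\<bar>"
  have C1: "1 \<le> C1" "C0 \<le> C1" "C0 + C0 \<le> C1" "Cf \<le> C1" "Cg \<le> C1" by (auto simp: C1_def)
  have "\<forall>\<^sub>F h in ?F. dq_bounded h (Suc s) (?D h) (step_const r \<bar>M\<bar> C1 s) (A h) \<and>
      dq_bounded h (Suc s) (?D h) (step_const r \<bar>M\<bar> C1 s) (B h)"
    using C C0 eventually_mesh
  proof eventually_elim
    case (elim h)
    note h = mesh_pos[OF elim(4)]
    have db: "deriv_bound (F h) (Suc s) (hull_of (?D h) (\<lambda>x y. (A h x y, B h x y))) C1"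
      "deriv_bound (G h) (Suc s) (hull_of (?D h) (\<lambda>x y. (A h x y, B h x y))) C1"
      using deriv_bound_mono[OF deriv_bound_const_mono[OF elim(1) C1(4)] Suc.prems K(2)[OF elim(4)]]
        deriv_bound_mono[OF deriv_bound_const_mono[OF elim(2) C1(5)] Suc.prems K(2)[OF elim(4)]] by blast+
    have u: "dq_bounded h s (?D h) C1 (\<lambda>x y. (A h x y, B h x y))"
      by (rule dq_bounded_mono[OF dq_bounded_Pair order_refl C1(3) order_refl]) (use elim(3) in auto)
    have AB: "dq_bounded h s (?D h) C1 (A h)" "dq_bounded h s (?D h) C1 (B h)"
      using elim(3) C1(2) by (auto intro: dq_bounded_mono)
    have data: "norm ((dq h ^^ Suc s) (a0 h) x) \<le> \<bar>M\<bar>" "norm ((dq h ^^ Suc s) (b0 h) x) \<le> \<bar>M\<bar>"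
      if "x \<in> grid h r" "x + real (Suc s) * h \<in> grid h r" for x
      using a0[OF elim(4) Suc.prems that] b0[OF elim(4) Suc.prems that] by linarith+
    show ?case
      using dq_bounded_system_step[OF f(3)[OF elim(4)] g(3)[OF elim(4)] h C1(1) abs_ge_zero db u AB
          sol[OF elim(4)] data]
      by blast
  qed
  then show ?case by blast
qed

lemma grid_limit_of_linear_rate:
  assumes "\<And>h x y. h \<in> mesh e0 \<Longrightarrow> (x, y) \<in> grid_square h r \<Longrightarrow> norm (U h x y - u x y) \<le> C * h"
  shows "grid_limit e0 r 0 U u"
  unfolding grid_limit_def
proof (intro allI impI)
  fix e :: real assume "0 < e"
  then have "0 < e / 2" by simp
  from eventually_mesh_mult_le[OF this, of C] eventually_mesh
  show "\<forall>\<^sub>F h in at 0 within mesh e0. \<forall>x y. (x, y) \<in> grid_square h (r - real 0 * h) \<longrightarrow>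
      norm (U h x y - u x y) < e"
  proof eventually_elim
    case (elim h)
    then show ?case using assms[of h] \<open>0 < e\<close> by fastforce
  qed
qed

theorem theorem2:
  fixes f g :: "'a::banach \<times> 'a \<Rightarrow> 'a"
    and F G :: "real \<Rightarrow> 'a \<times> 'a \<Rightarrow> 'a"
    and a\<^sub>0 b\<^sub>0 :: "real \<Rightarrow> 'a"
    and a\<^sub>0\<epsilon> b\<^sub>0\<epsilon> :: "real \<Rightarrow> real \<Rightarrow> 'a"
    and a\<epsilon> b\<epsilon> :: "real \<Rightarrow> real \<Rightarrow> real \<Rightarrow> 'a"
    and a b :: "real \<Rightarrow> real \<Rightarrow> 'a"
    and r rbar \<epsilon>\<^sub>0 M :: real
    and k :: nat
  assumes "0 < r" and "0 < \<epsilon>\<^sub>0"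
    and "C_k (k + 1) f" and "C_k (k + 1) g"
    and "C_1_interval r a\<^sub>0" and "C_1_interval r b\<^sub>0"
    and "\<And>\<epsilon>. \<epsilon> \<in> mesh \<epsilon>\<^sub>0 \<Longrightarrow> C_infinity (F \<epsilon>)"
    and "\<And>\<epsilon>. \<epsilon> \<in> mesh \<epsilon>\<^sub>0 \<Longrightarrow> C_infinity (G \<epsilon>)"
    and "C1_O_eps_approximation \<epsilon>\<^sub>0 F f" and "C1_O_eps_approximation \<epsilon>\<^sub>0 G g"
    and "O_eps_on \<epsilon>\<^sub>0 (\<lambda>\<epsilon>. grid \<epsilon> r) (\<lambda>\<epsilon> x. a\<^sub>0\<epsilon> \<epsilon> x - a\<^sub>0 x)"
    and "O_eps_on \<epsilon>\<^sub>0 (\<lambda>\<epsilon>. grid \<epsilon> r) (\<lambda>\<epsilon> y. b\<^sub>0\<epsilon> \<epsilon> y - b\<^sub>0 y)"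
    and "\<And>\<epsilon>. \<epsilon> \<in> mesh \<epsilon>\<^sub>0 \<Longrightarrow>
           discrete_goursat_solution \<epsilon> r (F \<epsilon>) (G \<epsilon>) (a\<^sub>0\<epsilon> \<epsilon>) (b\<^sub>0\<epsilon> \<epsilon>) (a\<epsilon> \<epsilon>) (b\<epsilon> \<epsilon>)"
    and "0 < rbar" and "rbar \<le> r"
    and "\<exists>L. L-lipschitz_on (square rbar) (\<lambda>(x, y). a x y)"
    and "\<exists>L. L-lipschitz_on (square rbar) (\<lambda>(x, y). b x y)"
    and "O_eps_on \<epsilon>\<^sub>0 (\<lambda>\<epsilon>. grid_square \<epsilon> rbar) (\<lambda>\<epsilon> (x, y). a\<epsilon> \<epsilon> x y - a x y)"
    and "O_eps_on \<epsilon>\<^sub>0 (\<lambda>\<epsilon>. grid_square \<epsilon> rbar) (\<lambda>\<epsilon> (x, y). b\<epsilon> \<epsilon> x y - b x y)"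
    and "goursat_solution rbar f g a\<^sub>0 b\<^sub>0 a b"
    and "\<And>\<epsilon> m x. \<epsilon> \<in> mesh \<epsilon>\<^sub>0 \<Longrightarrow> m \<le> k + 1 \<Longrightarrow> x \<in> grid \<epsilon> r \<Longrightarrow>
           x + real m * \<epsilon> \<in> grid \<epsilon> r \<Longrightarrow> norm ((dq \<epsilon> ^^ m) (a\<^sub>0\<epsilon> \<epsilon>) x) \<le> M"
    and "\<And>\<epsilon> n y. \<epsilon> \<in> mesh \<epsilon>\<^sub>0 \<Longrightarrow> n \<le> k + 1 \<Longrightarrow> y \<in> grid \<epsilon> r \<Longrightarrow>
           y + real n * \<epsilon> \<in> grid \<epsilon> r \<Longrightarrow> norm ((dq \<epsilon> ^^ n) (b\<^sub>0\<epsilon> \<epsilon>) y) \<le> M"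
    and "C_k_limit (k + 1) F f (at 0 within mesh \<epsilon>\<^sub>0)"
    and "C_k_limit (k + 1) G g (at 0 within mesh \<epsilon>\<^sub>0)"
  shows "C_k_square k rbar a \<and> C_k_square k rbar b \<and>
    (\<forall>m n. m + n \<le> k \<longrightarrow>
      ((\<lambda>\<epsilon>. SUP (x, y)\<in>grid_square \<epsilon> (rbar - real k * \<epsilon>).
          norm ((dq_x \<epsilon> ^^ m) ((dq_y \<epsilon> ^^ n) (a\<epsilon> \<epsilon>)) x y
              - (pd_x rbar ^^ m) ((pd_y rbar ^^ n) a) x y)) \<longlongrightarrow> 0) (at 0 within mesh \<epsilon>\<^sub>0) \<and>
      ((\<lambda>\<epsilon>. SUP (x, y)\<in>grid_square \<epsilon> (rbar - real k * \<epsilon>).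
          norm ((dq_x \<epsilon> ^^ m) ((dq_y \<epsilon> ^^ n) (b\<epsilon> \<epsilon>)) x y
              - (pd_x rbar ^^ m) ((pd_y rbar ^^ n) b) x y)) \<longlongrightarrow> 0) (at 0 within mesh \<epsilon>\<^sub>0))"
proof -
  let ?F = "at 0 within mesh \<epsilon>\<^sub>0"
  obtain Ca where Ca: "\<And>h x y. h \<in> mesh \<epsilon>\<^sub>0 \<Longrightarrow> (x, y) \<in> grid_square h rbar \<Longrightarrow>
      norm (a\<epsilon> h x y - a x y) \<le> Ca * h"
    using assms(18) unfolding O_eps_on_def by fast
  obtain Cb where Cb: "\<And>h x y. h \<in> mesh \<epsilon>\<^sub>0 \<Longrightarrow> (x, y) \<in> grid_square h rbar \<Longrightarrow>
      norm (b\<epsilon> h x y - b x y) \<le> Cb * h"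
    using assms(19) unfolding O_eps_on_def by fast
  have a: "continuous_on (square rbar) (case_prod a)" and b: "continuous_on (square rbar) (case_prod b)"
    using assms(16,17) lipschitz_on_continuous_on by blast+
  have grid: "x \<in> grid h r" if "x \<in> grid h rbar" for h x
    using grid_mono[OF assms(15)] that by blast
  obtain C where C: "\<forall>\<^sub>F h in ?F. dq_bounded h (k + 1) (grid_square h rbar) C (a\<epsilon> h) \<and>
      dq_bounded h (k + 1) (grid_square h rbar) C (b\<epsilon> h)"
    using eventually_dq_bounded_solution[OF assms(3,23,7,4,24,8) a Ca b Cb
        discrete_goursat_solution_mono[OF assms(13,15)]
        assms(21)[OF _ _ grid grid] assms(22)[OF _ _ grid grid] order_refl] by blast
  \<comment> \<open>One argument for \<open>a\<close> and \<open>b\<close>: no row has been lost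
    yet, so the induction starts at l = 0 and ends on the grid shrunk by \<open>k\<close>
    rows.\<close>
  have limit: "C_k_square k rbar u \<and> (\<forall>m n. m + n \<le> k \<longrightarrow>
      ((\<lambda>\<epsilon>. SUP (x, y)\<in>grid_square \<epsilon> (rbar - real k * \<epsilon>).
          norm ((dq_x \<epsilon> ^^ m) ((dq_y \<epsilon> ^^ n) (U \<epsilon>)) x y
              - (pd_x rbar ^^ m) ((pd_y rbar ^^ n) u) x y)) \<longlongrightarrow> 0) ?F)"
    if u: "continuous_on (square rbar) (case_prod u)" "grid_limit \<epsilon>\<^sub>0 rbar 0 U u"
      "\<forall>\<^sub>F h in ?F. dq_bounded h (k + 1) (grid_square h rbar) C (U h)" for u and U :: "real \<Rightarrow> real \<Rightarrow> real \<Rightarrow> 'a"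
  proof -
    have "\<forall>\<^sub>F h in ?F. dq_bounded h (Suc k) (grid_square h (rbar - real 0 * h)) C (U h)"
      using u(3) by (simp del: dq_bounded.simps)
    from C_k_square_of_grid_limit[OF assms(2,14) u(1,2) this]
    have "C_k_square k rbar u" and "\<And>m n. m + n \<le> k \<Longrightarrow>
        grid_limit \<epsilon>\<^sub>0 rbar k (\<lambda>h. (dq_x h ^^ m) ((dq_y h ^^ n) (U h))) ((pd_x rbar ^^ m) ((pd_y rbar ^^ n) u))"
      by simp_all
    then show ?thesis using tendsto_SUP_of_grid_limit[OF _ assms(14)] by blast
  qed
  have "\<forall>\<^sub>F h in ?F. dq_bounded h (k + 1) (grid_square h rbar) C (a\<epsilon> h)"
    "\<forall>\<^sub>F h in ?F. dq_bounded h (k + 1) (grid_square h rbar) C (b\<epsilon> h)"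
    using C unfolding eventually_conj_iff by blast+
  from limit[OF a grid_limit_of_linear_rate this(1)] limit[OF b grid_limit_of_linear_rate this(2)] Ca Cb
  show ?thesis by blast
qed

end
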